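(* There exists a function $\beta:\mathbb{N}\to\mathbb{N}$ such that for every integer $\ell\ge 1$, all $n\le m$ and every access sequence $X=(x_1,\dots,x_m)\in[n]^m$, \[\mathsf{OPT}(X)\le \beta(\ell)\cdot \mathsf{UB}^{\ell}(X),\qquad\text{where}\qquad \mathsf{UB}^{\ell}(X)=\sum_{t=1}^{m}\ \min_{t'\in[t-\ell,t),\ t'\ge 1}\log\big(|x_t-x_{t'}|+\rho_t(x_{t'})\big).\]
   Context: Throughout, $\log(x)$ denotes $\log_2(\max\{2,x\})$. Keys are $[n]=\{1,\dots,n\}$, and access sequences $X\in[n]^m$ satisfy $m\ge n$. Dynamic BST model: a binary search tree on the keys $[n]$ is maintained; to serve access $x_t$ a single pointer starts at the root, and the algorithm performs pointer moves (to the parent or a child) and rotations, the pointer having to visit the node holding $x_t$; the cost of an access is the number of such elementary operations plus one. $\mathsf{OPT}(X)$ is the minimum total cost of serving $X$ over all (offline) BST algorithms, with arbitrary initial tree. For a key $a$ and time $t$, $\rho_t(a)$ is the number of distinct keys accessed strictly between the last time $s<t$ with $x_s=a$ and time $t$ (all keys are considered accessed at time $0$). For $t=1$ the range of $t'$ is empty; the corresponding term is interpreted as $\log n$. *)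

theory Defs
  imports Complex_Main "HOL-Library.Tree"
begin

text \<open>A BST on keys [n] is a tree whose inorder traversal is 1,...,n.
 The pointer is represented by the path (False = left, True = right) from the root.\<close>

definition bst_on :: "nat \<Rightarrow> nat tree \<Rightarrow> bool" where
  "bst_on n T \<longleftrightarrow> inorder T = [1..<n+1]"

fun subtree_at :: "'a tree \<Rightarrow> bool list \<Rightarrow> 'a tree" where
  "subtree_at t [] = t"
| "subtree_at Leaf (d#ds) = Leaf"
| "subtree_at (Node l a r) (d#ds) = subtree_at (if d then r else l) ds"

fun replace_at :: "'a tree \<Rightarrow> bool list \<Rightarrow> 'a tree \<Rightarrow> 'a tree" where
  "replace_at t [] s = s"
| "replace_at Leaf (d#ds) s = Leaf"
| "replace_at (Node l a r) (d#ds) s =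
     (if d then Node l a (replace_at r ds s) else Node (replace_at l ds s) a r)"

fun rot_child :: "bool \<Rightarrow> 'a tree \<Rightarrow> 'a tree option" where
  "rot_child False (Node (Node ll b lr) a r) = Some (Node ll b (Node lr a r))"
| "rot_child True (Node l a (Node rl b rr)) = Some (Node (Node l a rl) b rr)"
| "rot_child _ _ = None"

datatype bst_op = MoveUp | MoveLeft | MoveRight | Rotate

type_synonym bst_state = "nat tree \<times> bool list"

fun bst_step :: "bst_op \<Rightarrow> bst_state \<Rightarrow> bst_state option" where
  "bst_step MoveUp (t, p) = (if p = [] then None else Some (t, butlast p))"
| "bst_step MoveLeft (t, p) =
     (if subtree_at t (p @ [False]) = Leaf then None else Some (t, p @ [False]))"
| "bst_step MoveRight (t, p) =
     (if subtree_at t (p @ [True]) = Leaf then None else Some (t, p @ [True]))"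
| "bst_step Rotate (t, p) =
     (if p = [] then None else
        (case rot_child (last p) (subtree_at t (butlast p)) of
           None \<Rightarrow> None
         | Some s \<Rightarrow> Some (replace_at t (butlast p) s, butlast p)))"

fun bst_run :: "bst_op list \<Rightarrow> bst_state \<Rightarrow> bst_state list option" where
  "bst_run [] s = Some [s]"
| "bst_run (o1 # os) s =
     (case bst_step o1 s of
        None \<Rightarrow> None
      | Some s' \<Rightarrow> map_option (Cons s) (bst_run os s'))"

definition key_at :: "bst_state \<Rightarrow> nat option" where
  "key_at s = (case subtree_at (fst s) (snd s) of Leaf \<Rightarrow> None | Node _ a _ \<Rightarrow> Some a)"

fun serve_cost :: "nat tree \<Rightarrow> bst_op list list \<Rightarrow> nat list \<Rightarrow> nat option" where
  "serve_cost t [] [] = Some 0"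
| "serve_cost t (ops # opss) (x # xs) =
     (case bst_run ops (t, []) of
        None \<Rightarrow> None
      | Some sts \<Rightarrow>
          (if (\<exists>s\<in>set sts. key_at s = Some x)
           then map_option (\<lambda>c. length ops + 1 + c) (serve_cost (fst (last sts)) opss xs)
           else None))"
| "serve_cost t _ _ = None"

definition OPT :: "nat \<Rightarrow> nat list \<Rightarrow> nat" where
  "OPT n X = (LEAST c. \<exists>T0 opss. bst_on n T0 \<and> serve_cost T0 opss X = Some c)"

definition lg :: "real \<Rightarrow> real" where
  "lg x = log 2 (max 2 x)"

definition acc :: "nat list \<Rightarrow> nat \<Rightarrow> nat" where
  "acc X t = X ! (t - 1)"

definition last_access :: "nat list \<Rightarrow> nat \<Rightarrow> nat \<Rightarrow> nat" where
  "last_access X a t =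
     (if \<exists>s\<in>{1..<t}. acc X s = a then Max {s\<in>{1..<t}. acc X s = a} else 0)"

definition rho :: "nat list \<Rightarrow> nat \<Rightarrow> nat \<Rightarrow> nat" where
  "rho X t a = card {acc X u | u. last_access X a t < u \<and> u < t}"

definition UB :: "nat \<Rightarrow> nat \<Rightarrow> nat list \<Rightarrow> real" where
  "UB l n X = (\<Sum>t = 1..length X.
     (if t = 1 then lg (real n)
      else Min ((\<lambda>t'. lg (\<bar>real (acc X t) - real (acc X t')\<bar> + real (rho X t (acc X t'))))
                 ` {t'. t - l \<le> t' \<and> t' < t \<and> 1 \<le> t'})))"

end

theory Submission
  imports Defs
begin

text \<open>
  A binary search tree that is heap-ordered by the next time each key is touched serves an
  arborally satisfied family of touched key sets \<open>P t\<close> at cost \<open>O(\<Sum>t. card (P t))\<close>: the touched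
  keys form the top of the tree, and any two shapes of the top are joined through a right vine.

  To obtain such sets, shift the keys by some \<open>\<sigma>\<close> and call a dyadic cell active if it contains one
  of the last \<open>l\<close> accesses. At each access touch the end points of the active cells up to the
  highest level at which the set of active cells changes. The number of new active cells is at
  most the number of levels separating the accessed key from any given one of the previous \<open>l\<close>
  accesses, which on average over the shifts is at most logarithmic in their distance. Hence even
  the bound without the terms \<open>rho\<close> holds.
\<close>

section \<open>Heap-ordered trees\<close>

text \<open>Rebuilding the top of the tree keeps the heap order exactly when each touched key is
  touched again no later than every key of the two untouched subtrees next to it; arboral
  satisfaction supplies this. The obstacle is to find sets with this property whose size follows the
  changes of the cells. Touching the parent of a changing cell along with the cell is what makes it
  work: the midpoint of the parent is then touched together with the parent's ends. Departing cells
  must be touched like arriving ones. They are charged to the earlier arrivals, and the cells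
  present at the start are paid by the term \<open>lg n\<close> of the first access. The shift is
  needed because a fixed dyadic grid can separate two neighbouring keys on almost every level. All
  accesses in the window keep their cells active, so the best \<open>t'\<close> never has to be
  known; the price is the factor \<open>l + 1\<close>, the number of points that can contribute a
  touched cell on one level.\<close>

definition reach :: "nat \<Rightarrow> bst_state \<Rightarrow> nat set \<Rightarrow> bst_state \<Rightarrow> bool" where
  "reach c s V s' \<longleftrightarrow> (\<exists>ops sts. bst_run ops s = Some sts \<and> last sts = s' \<and> length ops \<le> c \<and>
     (\<forall>x\<in>V. \<exists>u\<in>set sts. key_at u = Some x))"

lemma bst_run_hd: "bst_run ops s = Some sts \<Longrightarrow> \<exists>r. sts = s # r"
  by (cases ops) (auto split: option.splits)

lemma bst_run_append:
  "bst_run os s = Some sts \<Longrightarrow> bst_run os' (last sts) = Some sts' \<Longrightarrow>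
   bst_run (os @ os') s = Some (sts @ tl sts')"
proof (induction os arbitrary: s sts)
  case Nil
  then show ?case using bst_run_hd by fastforce
next
  case (Cons a os)
  from Cons.prems(1) obtain s1 sts1 where s1: "bst_step a s = Some s1" "bst_run os s1 = Some sts1"
    "sts = s # sts1" by (auto split: option.splits)
  moreover have "sts1 \<noteq> []" using bst_run_hd[OF s1(2)] by auto
  ultimately show ?case using Cons.IH[OF s1(2)] Cons.prems(2) by simp
qed

lemma reach_trans:
  assumes "reach c s V s'" "reach c' s' W s''"
  shows "reach (c + c') s (V \<union> W) s''"
proof -
  from assms(1) obtain os sts where 1: "bst_run os s = Some sts" "last sts = s'" "length os \<le> c"
    "\<forall>x\<in>V. \<exists>u\<in>set sts. key_at u = Some x" unfolding reach_def by blast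
  from assms(2) obtain os' sts' where 2: "bst_run os' s' = Some sts'" "last sts' = s''" "length os' \<le> c'"
    "\<forall>x\<in>W. \<exists>u\<in>set sts'. key_at u = Some x" unfolding reach_def by blast
  obtain r where r: "sts = s # r" using bst_run_hd[OF 1(1)] by blast
  obtain r' where r': "sts' = s' # r'" using bst_run_hd[OF 2(1)] by blast
  have run: "bst_run (os @ os') s = Some (sts @ r')"
    using bst_run_append[OF 1(1), of os' sts'] 1(2) 2(1) r' by simp
  have "s' \<in> set sts" using 1(2) r by (metis last_in_set list.distinct(1))
  then have "set (sts @ r') = set sts \<union> set sts'" using r' by auto
  moreover have "last (sts @ r') = s''" using 1(2) 2(2) r' by (cases r') auto
  ultimately show ?thesis unfolding reach_def using run 1(3,4) 2(3,4)
    by (intro exI[of _ "os @ os'"] exI[of _ "sts @ r'"]) auto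
qed

lemma reach_mono: "reach c s V s' \<Longrightarrow> c \<le> c' \<Longrightarrow> W \<subseteq> V \<Longrightarrow> reach c' s W s'"
  unfolding reach_def by clarify (metis le_trans subsetD)

lemma reach_step: "bst_step a s = Some s' \<Longrightarrow> reach 1 s {} s'"
  unfolding reach_def by (intro exI[of _ "[a]"] exI[of _ "[s, s']"]) simp

lemma reach_here: "key_at s = Some x \<Longrightarrow> reach 0 s {x} s"
  unfolding reach_def by (intro exI[of _ "[]"] exI[of _ "[s]"]) simp

lemma reach_refl: "reach c s {} s"
  unfolding reach_def by (intro exI[of _ "[]"] exI[of _ "[s]"]) simp

lemma bst_step_right:
  "bst_step c (r, p) = Some (r', p') \<Longrightarrow>
   bst_step c (Node l a r, True # p) = Some (Node l a r', True # p')"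
  by (cases c) (auto split: if_splits option.splits)

lemma bst_run_right:
  "bst_run os (r, p) = Some sts \<Longrightarrow>
   bst_run os (Node l a r, True # p) = Some (map (\<lambda>(u, q). (Node l a u, True # q)) sts)"
proof (induction os arbitrary: r p sts)
  case (Cons c os)
  from Cons.prems obtain r1 p1 sts1 where s1: "bst_step c (r, p) = Some (r1, p1)"
    "bst_run os (r1, p1) = Some sts1" "sts = (r, p) # sts1" by (auto split: option.splits)
  show ?case using bst_step_right[OF s1(1)] Cons.IH[OF s1(2)] s1(3) by simp
qed simp

text \<open>A run that succeeds inside \<open>r\<close> never steps above its root, so the same
  operations can be replayed below \<open>a\<close>.\<close>

lemma reach_right:
  assumes "reach c (r, p) V (r', p')"
  shows "reach c (Node l a r, True # p) V (Node l a r', True # p')"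
proof -
  let ?f = "\<lambda>(u, q). (Node l a u, True # q)"
  from assms obtain os sts where 1: "bst_run os (r, p) = Some sts" "last sts = (r', p')" "length os \<le> c"
    "\<forall>x\<in>V. \<exists>u\<in>set sts. key_at u = Some x" unfolding reach_def by blast
  have k: "key_at (?f u) = key_at u" for u by (cases u) (simp add: key_at_def)
  have "sts \<noteq> []" using bst_run_hd[OF 1(1)] by auto
  then have "last (map ?f sts) = (Node l a r', True # p')" using 1(2) by (simp add: last_map)
  then show ?thesis unfolding reach_def
    using bst_run_right[OF 1(1)] 1(3,4) k
    by (intro exI[of _ os] exI[of _ "map ?f sts"]) (auto simp: image_iff)
qed

text \<open>\<open>topcut k xs s T\<close>: an ancestor-closed set of keys of \<open>T\<close> is listed in symmetric order by
  \<open>xs\<close>, each key paired with the untouched subtree on its left; \<open>s\<close> is the last untouched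
  subtree, and \<open>k\<close> is the number of listed keys off the right spine.\<close>

inductive topcut :: "nat \<Rightarrow> (nat tree \<times> nat) list \<Rightarrow> nat tree \<Rightarrow> nat tree \<Rightarrow> bool" where
  topcut_Nil: "topcut 0 [] s s"
| topcut_Node: "topcut k xs s l \<Longrightarrow> topcut k' ys s' r \<Longrightarrow>
    topcut (length xs + k') (xs @ (s, a) # ys) s' (Node l a r)"

fun vine :: "(nat tree \<times> nat) list \<Rightarrow> nat tree \<Rightarrow> nat tree" where
  "vine [] s = s"
| "vine ((u, a) # xs) s = Node u a (vine xs s)"

lemma topcut_le: "topcut k xs s T \<Longrightarrow> k \<le> length xs"
  by (induction rule: topcut.induct) auto

lemma topcut_NilD: "topcut k [] s T \<Longrightarrow> k = 0 \<and> s = T"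
  by (erule topcut.cases) auto

lemma topcut_inorder:
  "topcut k xs s T \<Longrightarrow> inorder T = concat (map (\<lambda>(u, a). inorder u @ [a]) xs) @ inorder s"
  by (induction rule: topcut.induct) auto

text \<open>Tree-to-vine flattening. A rotation at the root brings one more key onto the right
  spine; if no listed key lies to the left, the pointer goes down the spine. A rotation with its
  preceding move costs two operations, and so does a descent with its later ascent.\<close>

lemma topcut_reach:
  "topcut k xs s T \<Longrightarrow>
   reach (2 * length xs + 2 * k) (T, []) (snd ` set xs) (vine xs s, []) \<and>
   reach (2 * length xs + 2 * k) (vine xs s, []) {} (T, [])"
proof (induction "k + length xs" arbitrary: k xs s T rule: less_induct)
  case less
  from less.prems show ?case
  proof cases
    case topcut_Nil
    then show ?thesis using reach_refl by simp
  next
    case (topcut_Node k1 xs1 s1 l k2 ys r a)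
    note defs = this
    have here: "reach 0 (T, []) {a} (T, [])"
      using defs by (intro reach_here) (simp add: key_at_def)
    show ?thesis
    proof (cases "xs1 = []")
      case True
      then have l: "l = s1" using topcut_NilD defs by blast
      have xs: "xs = (s1, a) # ys" and k: "k = k2" using True defs by auto
      \<comment> \<open>The walk ends at the last listed key: the remainder \<open>s\<close> must
        stay untouched and may be a \<open>Leaf\<close>, into which the pointer cannot move.\<close>
      show ?thesis
      proof (cases "ys = []")
        case True
        then have "r = s" using topcut_NilD defs by blast
        then have v: "vine xs s = T" using xs True defs l by simp
        show ?thesis unfolding v using reach_mono[OF here] reach_refl xs True by auto
      next
        case False
        obtain rl b rr where r: "r = Node rl b rr" using \<open>topcut k2 ys s r\<close> False
          by cases auto
        have IH: "reach (2 * length ys + 2 * k2) (r, []) (snd ` set ys) (vine ys s, []) \<and>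
           reach (2 * length ys + 2 * k2) (vine ys s, []) {} (r, [])"
          by (rule less.hyps) (use xs k defs in auto)
        have v: "vine xs s = Node l a (vine ys s)" using xs l by simp
        have nL: "vine ys s \<noteq> Leaf" using False by (cases ys) auto
        have d1: "reach 1 (T, []) {} (T, [True])"
          by (rule reach_step[of MoveRight]) (simp add: defs r)
        have u1: "reach 1 (T, [True]) {} (T, [])"
          by (rule reach_step[of MoveUp]) simp
        have d2: "reach 1 (vine xs s, []) {} (vine xs s, [True])"
          by (rule reach_step[of MoveRight]) (simp add: v nL)
        have u2: "reach 1 (vine xs s, [True]) {} (vine xs s, [])"
          by (rule reach_step[of MoveUp]) simp
        have m1: "reach (2 * length ys + 2 * k2) (T, [True]) (snd ` set ys) (vine xs s, [True])"
          using reach_right[of _ r "[]" _ "vine ys s" "[]" l a] IH defs v by auto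
        have m2: "reach (2 * length ys + 2 * k2) (vine xs s, [True]) {} (T, [True])"
          using reach_right[of _ "vine ys s" "[]" _ r "[]" l a] IH defs v by auto
        show ?thesis
        proof
          show "reach (2 * length xs + 2 * k) (T, []) (snd ` set xs) (vine xs s, [])"
            by (rule reach_mono[OF reach_trans[OF here reach_trans[OF d1 reach_trans[OF m1 u2]]]])
               (auto simp: xs k)
          show "reach (2 * length xs + 2 * k) (vine xs s, []) {} (T, [])"
            by (rule reach_mono[OF reach_trans[OF d2 reach_trans[OF m2 u1]]])
               (auto simp: xs k)
        qed
      qed
    next
      case False
      from \<open>topcut k1 xs1 s1 l\<close> False obtain kl la sl ll kr lb b lr where
        c: "xs1 = la @ (sl, b) # lb" "l = Node ll b lr" "topcut kl la sl ll" "topcut kr lb s1 lr"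
        by cases auto
      \<comment> \<open>Rotating \<open>b\<close> above \<open>a\<close> puts \<open>b\<close> on
        the right spine and leaves the listed sequence as it is, so only \<open>k\<close> drops, by
        one.\<close>
      define T' where "T' = Node ll b (Node lr a r)"
      have "topcut (length la + (length lb + k2)) (la @ (sl, b) # (lb @ (s1, a) # ys)) s T'"
        unfolding T'_def using topcut.topcut_Node[OF c(3) topcut.topcut_Node[OF c(4) \<open>topcut k2 ys s r\<close>]] .
      moreover have "k - 1 = length la + (length lb + k2)" "xs = la @ (sl, b) # (lb @ (s1, a) # ys)"
        using defs(1,2) c(1) by simp_all
      ultimately have ct: "topcut (k - 1) xs s T'" by simp
      have k: "k > 0" using defs c by auto
      have IH: "reach (2 * length xs + 2 * (k - 1)) (T', []) (snd ` set xs) (vine xs s, []) \<and>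
           reach (2 * length xs + 2 * (k - 1)) (vine xs s, []) {} (T', [])"
        by (rule less.hyps[OF _ ct]) (use k in auto)
      have d1: "reach 1 (T, []) {} (T, [False])"
        by (rule reach_step[of MoveLeft]) (simp add: defs c)
      have d2: "reach 1 (T, [False]) {} (T', [])"
        by (rule reach_step[of Rotate]) (simp add: defs c T'_def)
      have e1: "reach 1 (T', []) {} (T', [True])"
        by (rule reach_step[of MoveRight]) (simp add: T'_def)
      have e2: "reach 1 (T', [True]) {} (T, [])"
        by (rule reach_step[of Rotate]) (simp add: defs c T'_def)
      show ?thesis
      proof
        show "reach (2 * length xs + 2 * k) (T, []) (snd ` set xs) (vine xs s, [])"
          by (rule reach_mono[OF reach_trans[OF d1 reach_trans[OF d2 conjunct1[OF IH]]]]) (use k in auto)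
        show "reach (2 * length xs + 2 * k) (vine xs s, []) {} (T, [])"
          by (rule reach_mono[OF reach_trans[OF conjunct2[OF IH] reach_trans[OF e1 e2]]]) (use k in auto)
      qed
    qed
  qed
qed

text \<open>As \<open>k\<close> is at most \<open>length xs\<close>, flattening and unflattening
  cost four operations per listed key each.\<close>

lemma topcut_exchange:
  assumes "topcut k xs s T" "topcut k' xs s T'"
  shows "reach (8 * length xs) (T, []) (snd ` set xs) (T', [])"
  by (rule reach_mono[OF reach_trans[OF conjunct1[OF topcut_reach[OF assms(1)]] conjunct2[OF topcut_reach[OF assms(2)]]]])
     (use topcut_le[OF assms(1)] topcut_le[OF assms(2)] in auto)

section \<open>Rebuilding the top of a heap-ordered tree\<close>

fun heap_by :: "(nat \<Rightarrow> nat) \<Rightarrow> nat tree \<Rightarrow> bool" where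
  "heap_by f Leaf = True"
| "heap_by f (Node l a r) =
     (heap_by f l \<and> heap_by f r \<and> (\<forall>x\<in>set_tree l \<union> set_tree r. f a \<le> f x))"

lemma heap_by_cong: "(\<And>x. x \<in> set_tree T \<Longrightarrow> f x = g x) \<Longrightarrow> heap_by f T = heap_by g T"
  by (induction T) auto

text \<open>As \<open>t\<close> bounds \<open>f\<close> from below, heap order puts the keys of
  value \<open>t\<close> above all others.\<close>

lemma heap_by_cut:
  assumes "heap_by f T" "\<forall>x\<in>set_tree T. t \<le> f x"
  shows "\<exists>k xs s. topcut k xs s T \<and> (\<forall>(u, a)\<in>set xs. f a = t) \<and>
    (\<forall>u\<in>insert s (fst ` set xs). heap_by f u \<and> (\<forall>x\<in>set_tree u. t < f x))"
  using assms
proof (induction T)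
  case Leaf
  show ?case by (rule exI[of _ 0], rule exI[of _ "[]"], rule exI[of _ Leaf]) (simp add: topcut_Nil)
next
  case (Node l a r)
  show ?case
  proof (cases "f a = t")
    case True
    from Node obtain k xs s where 1: "topcut k xs s l" "\<forall>(u, a)\<in>set xs. f a = t"
      "\<forall>u\<in>insert s (fst ` set xs). heap_by f u \<and> (\<forall>x\<in>set_tree u. t < f x)" by auto
    from Node obtain k' ys s' where 2: "topcut k' ys s' r" "\<forall>(u, a)\<in>set ys. f a = t"
      "\<forall>u\<in>insert s' (fst ` set ys). heap_by f u \<and> (\<forall>x\<in>set_tree u. t < f x)" by auto
    show ?thesis
      by (intro exI conjI, rule topcut_Node[OF 1(1) 2(1)]) (use 1(2,3) 2(2,3) True in auto)
  next
    case False
    then have "t < f a" using Node.prems(2) by fastforce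
    then have "\<forall>x\<in>set_tree (Node l a r). t < f x"
      using Node.prems(1) less_le_trans by auto
    then show ?thesis using Node.prems
      by (intro exI[of _ 0] exI[of _ "[]"] exI[of _ "Node l a r"]) (simp add: topcut_Nil)
  qed
qed

definition next_tree :: "(nat tree \<times> nat) list \<Rightarrow> nat tree \<Rightarrow> nat tree" where
  "next_tree zs s = (case zs of [] \<Rightarrow> s | (u, _) # _ \<Rightarrow> u)"

text \<open>Treap construction: the listed key of least \<open>f\<close> becomes the root. Comparing
  keys with adjacent untouched subtrees (\<open>u\<close> on the left, \<open>next_tree zs s\<close>
  on the right) suffices, because every untouched subtree has a listed neighbour and the root is at
  most that neighbour.\<close>

lemma topcut_heap_ex:
  assumes "\<forall>u\<in>insert s (fst ` set xs). heap_by f u"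
    and "\<And>ys u a zs. xs = ys @ (u, a) # zs \<Longrightarrow>
      \<forall>x\<in>set_tree u \<union> set_tree (next_tree zs s). f a \<le> f x"
  shows "\<exists>k T. topcut k xs s T \<and> heap_by f T"
  using assms
proof (induction "length xs" arbitrary: xs s rule: less_induct)
  case less
  show ?case
  proof (cases "xs = []")
    case True
    then show ?thesis using less.prems(1) topcut_Nil by auto
  next
    case False
    define p where "p = arg_min_on (f \<circ> snd) (set xs)"
    have p: "p \<in> set xs" unfolding p_def using False by (intro arg_min_if_finite(1)) auto
    have pm: "(f \<circ> snd) p \<le> (f \<circ> snd) q" if "q \<in> set xs" for q
      unfolding p_def using False that by (intro arg_min_least) auto
    obtain u a where ua: "p = (u, a)" by (cases p)
    obtain ys zs where xs: "xs = ys @ (u, a) # zs" using p ua by (metis split_list)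
    have "\<exists>k T. topcut k ys u T \<and> heap_by f T"
    proof (rule less.hyps)
      show "\<forall>v\<in>insert u (fst ` set ys). heap_by f v" using less.prems(1) xs by auto
      fix ys' u' a' zs' assume ys: "ys = ys' @ (u', a') # zs'"
      show "\<forall>x\<in>set_tree u' \<union> set_tree (next_tree zs' u). f a' \<le> f x"
        using less.prems(2)[of ys' u' a' "zs' @ (u, a) # zs"] xs ys
        by (cases zs') (auto simp: next_tree_def)
    qed (use xs in auto)
    then obtain k1 T1 where T1: "topcut k1 ys u T1" "heap_by f T1" by blast
    have "\<exists>k T. topcut k zs s T \<and> heap_by f T"
    proof (rule less.hyps)
      show "\<forall>v\<in>insert s (fst ` set zs). heap_by f v" using less.prems(1) xs by auto
      fix ys' u' a' zs' assume "zs = ys' @ (u', a') # zs'"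
      then show "\<forall>x\<in>set_tree u' \<union> set_tree (next_tree zs' s). f a' \<le> f x"
        using less.prems(2)[of "ys @ (u, a) # ys'" u' a' zs'] xs by auto
    qed (use xs in auto)
    then obtain k2 T2 where T2: "topcut k2 zs s T2" "heap_by f T2" by blast
    have key: "f a \<le> f b" if "(v, b) \<in> set xs" for v b using pm[OF that] ua by simp
    have hang: "f a \<le> f x" if v: "v \<in> insert s (fst ` set xs)" "x \<in> set_tree v" for v x
    proof (cases "v = s")
      case True
      obtain ys' w b where l: "xs = ys' @ [(w, b)]" using False by (metis rev_exhaust surj_pair)
      then have "f b \<le> f x" using less.prems(2)[of ys' w b "[]"] v True by (auto simp: next_tree_def)
      then show ?thesis using key[of w b] l by auto
    next
      case False
      then obtain b where "(v, b) \<in> set xs" using v(1) by auto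
      then obtain ys' zs' where "xs = ys' @ (v, b) # zs'" by (metis split_list)
      from less.prems(2)[OF this] v(2) have "f b \<le> f x" by simp
      then show ?thesis using key[OF \<open>(v, b) \<in> set xs\<close>] by simp
    qed
    have below: "f a \<le> f x"
      if t: "topcut k xs' v' T" "set xs' \<subseteq> set xs" "v' \<in> insert s (fst ` set xs)" "x \<in> set_tree T"
      for k xs' v' T x
    proof -
      have "x \<in> set (inorder T)" using t(4) by simp
      then consider v b where "(v, b) \<in> set xs" "x = b \<or> x \<in> set_tree v" | "x \<in> set_tree v'"
        unfolding topcut_inorder[OF t(1)] using t(2) by auto
      then show ?thesis
      proof cases
        case (1 v b)
        then show ?thesis using key hang[of v x] by force
      next
        case 2
        then show ?thesis using hang[OF t(3)] by simp
      qed
    qed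
    have "\<forall>x\<in>set_tree T1 \<union> set_tree T2. f a \<le> f x"
      using below[OF T1(1)] below[OF T2(1)] xs by auto
    then have "heap_by f (Node T1 a T2)" using T1(2) T2(2) by simp
    then show ?thesis using topcut_Node[OF T1(1) T2(1)] xs by blast
  qed
qed

section \<open>Next touch times and the cost of a satisfied family\<close>

text \<open>Every time after \<open>m\<close> counts as a touch, so the minimum exists and keys that
  are not touched again get the largest value.\<close>

definition next_touch :: "nat \<Rightarrow> (nat \<Rightarrow> nat set) \<Rightarrow> nat \<Rightarrow> nat \<Rightarrow> nat" where
  "next_touch m P t a = (LEAST v. t \<le> v \<and> (m < v \<or> a \<in> P v))"

lemma next_touch_props:
  "t \<le> next_touch m P t a \<and> (m < next_touch m P t a \<or> a \<in> P (next_touch m P t a))"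
  unfolding next_touch_def by (rule LeastI[of _ "max t (Suc m)"]) auto

lemma next_touch_le: "t \<le> v \<Longrightarrow> m < v \<or> a \<in> P v \<Longrightarrow> next_touch m P t a \<le> v"
  unfolding next_touch_def by (rule Least_le) auto

lemma next_touch_eq: "a \<in> P t \<Longrightarrow> next_touch m P t a = t"
  using next_touch_le[of t t m a P] next_touch_props[of t m P a] by auto

lemma next_touch_Suc:
  assumes "t \<le> m" "a \<notin> P t"
  shows "next_touch m P (Suc t) a = next_touch m P t a"
proof (rule antisym)
  have "next_touch m P t a \<noteq> t" using next_touch_props[of t m P a] assms by auto
  then show "next_touch m P (Suc t) a \<le> next_touch m P t a"
    using next_touch_props[of t m P a] by (intro next_touch_le) auto
  show "next_touch m P t a \<le> next_touch m P (Suc t) a"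
    using next_touch_props[of "Suc t" m P a] by (intro next_touch_le) auto
qed

lemma distinct_cut_keys:
  "distinct (concat (map (\<lambda>(u, a). inorder u @ [a]) xs) @ ys) \<Longrightarrow> distinct (map snd xs)"
  by (induction xs) force+

text \<open>This is arboral satisfaction of the point set \<open>{(t, a). a \<in> P t}\<close>.\<close>

definition satisfied :: "nat \<Rightarrow> (nat \<Rightarrow> nat set) \<Rightarrow> bool" where
  "satisfied m P \<longleftrightarrow> (\<forall>t t' a g. 1 \<le> t \<longrightarrow> t < t' \<longrightarrow> t' \<le> m \<longrightarrow> a \<in> P t \<longrightarrow> g \<in> P t' \<longrightarrow>
     (\<forall>v\<in>{t..<t'}. \<forall>b\<in>P v. \<not> (a < b \<and> b \<le> g) \<and> \<not> (g \<le> b \<and> b < a)) \<longrightarrow>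
     (\<exists>v\<in>{t<..t'}. a \<in> P v))"

text \<open>Take the first time \<open>w\<close> after \<open>t\<close> that touches some
  \<open>g\<close> on the way from \<open>a\<close> to \<open>x\<close>. Nothing on the way from
  \<open>a\<close> to \<open>g\<close> is touched from \<open>t\<close> until \<open>w\<close>, so
  satisfaction forces a touch of \<open>a\<close> by time \<open>w\<close>, and \<open>w\<close> is
  no later than the next touch of \<open>x\<close>.\<close>

lemma satisfied_next_touch_le:
  assumes sat: "satisfied m P" and t: "1 \<le> t" "t \<le> m" and a: "a \<in> P t"
    and free: "\<forall>b\<in>P t. \<not> (a < b \<and> b \<le> x) \<and> \<not> (x \<le> b \<and> b < a)"
  shows "next_touch m P (Suc t) a \<le> next_touch m P (Suc t) x"
proof (cases "m < next_touch m P (Suc t) x")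
  case True
  then show ?thesis using next_touch_props[of "Suc t" m P x] by (intro next_touch_le) auto
next
  case False
  let ?t' = "next_touch m P (Suc t) x"
  \<comment> \<open>The keys from \<open>a\<close> to \<open>x\<close> without \<open>a\<close>; the
    last disjunct matters for \<open>x = a\<close>.\<close>
  define R where "R g \<longleftrightarrow> a < g \<and> g \<le> x \<or> x \<le> g \<and> g < a \<or> g = x" for g
  define w where "w = (LEAST v. t < v \<and> (\<exists>g\<in>P v. R g))"
  have x: "t < ?t' \<and> (\<exists>g\<in>P ?t'. R g)"
    using next_touch_props[of "Suc t" m P x] False by (auto simp: R_def)
  have "t < w \<and> (\<exists>g\<in>P w. R g)" unfolding w_def
    by (rule LeastI[where P = "\<lambda>v. t < v \<and> (\<exists>g\<in>P v. R g)", OF x])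
  then obtain g where g: "t < w" "g \<in> P w" "R g" by blast
  have w: "w \<le> ?t'" unfolding w_def
    by (rule Least_le[where P = "\<lambda>v. t < v \<and> (\<exists>g\<in>P v. R g)", OF x])
  have min: "\<not> R b" if "t < v" "v < w" "b \<in> P v" for v b
    using not_less_Least[of v "\<lambda>v. t < v \<and> (\<exists>g\<in>P v. R g)"] that unfolding w_def by blast
  have "\<forall>v\<in>{t..<w}. \<forall>b\<in>P v. \<not> (a < b \<and> b \<le> g) \<and> \<not> (g \<le> b \<and> b < a)"
  proof (intro ballI)
    fix v b assume v: "v \<in> {t..<w}" "b \<in> P v"
    show "\<not> (a < b \<and> b \<le> g) \<and> \<not> (g \<le> b \<and> b < a)"
    proof (cases "v = t")
      case True
      then show ?thesis using free v(2) g(3) unfolding R_def by (meson le_less_trans less_le_trans le_trans nat_le_linear not_le)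
    next
      case False
      then have "\<not> R b" using min[of v b] v by simp
      then show ?thesis using g(3) unfolding R_def by auto
    qed
  qed
  moreover have "w \<le> m" using w False by simp
  ultimately have "\<exists>v\<in>{t<..w}. a \<in> P v"
    using sat t g(1,2) a unfolding satisfied_def by simp
  then obtain v where "v \<in> {t<..w}" "a \<in> P v" by blast
  then have "next_touch m P (Suc t) a \<le> v" by (intro next_touch_le) auto
  also have "v \<le> ?t'" using \<open>v \<in> {t<..w}\<close> w by simp
  finally show ?thesis .
qed

text \<open>The top cut off at time \<open>t\<close> consists of exactly the keys of
  \<open>P t\<close>. Untouched keys keep their next touch time, and no key of \<open>P t\<close>
  lies between a touched key and an adjacent untouched subtree, so
  \<open>satisfied_next_touch_le\<close> applies there.\<close>

lemma heap_step:
  assumes sat: "satisfied m P" and t: "1 \<le> t" "t \<le> m" and P: "P t \<subseteq> {1..n}"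
    and T: "inorder T = [1..<n+1]" "heap_by (next_touch m P t) T"
  shows "\<exists>T'. inorder T' = [1..<n+1] \<and> heap_by (next_touch m P (Suc t)) T' \<and>
    reach (8 * card (P t)) (T, []) (P t) (T', [])"
proof -
  have "\<forall>x\<in>set_tree T. t \<le> next_touch m P t x" using next_touch_props by auto
  from heap_by_cut[OF T(2) this] obtain k xs s where cut: "topcut k xs s T" and keys: "\<forall>(u, a)\<in>set xs. next_touch m P t a = t"
    and hang: "\<forall>u\<in>insert s (fst ` set xs). heap_by (next_touch m P t) u \<and>
      (\<forall>x\<in>set_tree u. t < next_touch m P t x)"
    by auto
  note io = topcut_inorder[OF cut]
  have hP: "x \<notin> P t" if "u \<in> insert s (fst ` set xs)" "x \<in> set_tree u" for u x
    using that hang next_touch_eq[of x P t m] by (metis less_irrefl)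
  have sub: "snd ` set xs \<subseteq> P t"
  proof
    fix a assume "a \<in> snd ` set xs"
    then have "next_touch m P t a = t" using keys by auto
    then show "a \<in> P t" using next_touch_props[of t m P a] t by auto
  qed
  moreover have "P t \<subseteq> snd ` set xs"
  proof
    fix a assume a: "a \<in> P t"
    then have "a \<in> set (inorder T)" using P T(1) by auto
    then consider v b where "(v, b) \<in> set xs" "a = b \<or> a \<in> set_tree v" | "a \<in> set_tree s"
      unfolding io by auto
    then show "a \<in> snd ` set xs"
    proof cases
      case (1 v b)
      then have "a = b" using hP[of v a] a by force
      then show ?thesis using 1(1) by force
    qed (use hP[of s a] a in auto)
  qed
  ultimately have ks: "snd ` set xs = P t" by blast
  have "distinct (inorder T)" using T(1) by simp
  then have "distinct (map snd xs)" unfolding io by (rule distinct_cut_keys)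
  then have len: "length xs = card (P t)" using distinct_card[of "map snd xs"] ks by simp
  have sorted: "sorted_wrt (<) (inorder T)" unfolding T(1) by (rule sorted_wrt_upt)
  have "\<exists>k T'. topcut k xs s T' \<and> heap_by (next_touch m P (Suc t)) T'"
  proof (rule topcut_heap_ex)
    show "\<forall>u\<in>insert s (fst ` set xs). heap_by (next_touch m P (Suc t)) u"
    proof
      fix u assume u: "u \<in> insert s (fst ` set xs)"
      have "heap_by (next_touch m P (Suc t)) u = heap_by (next_touch m P t) u"
        by (rule heap_by_cong) (use hP[OF u] t in \<open>simp add: next_touch_Suc\<close>)
      then show "heap_by (next_touch m P (Suc t)) u" using bspec[OF hang u] by simp
    qed
    fix ys u a zs assume xs: "xs = ys @ (u, a) # zs"
    let ?F = "\<lambda>xs. concat (map (\<lambda>(u, a). inorder u @ [a]) xs)"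
    have k: "snd ` set zs \<subseteq> set (?F zs)" for zs :: "(nat tree \<times> nat) list" by force
    have P_t: "P t = snd ` set ys \<union> {a} \<union> snd ` set zs" using ks xs by auto
    have so: "sorted_wrt (<) (?F ys @ inorder u @ [a] @ ?F zs @ inorder s)"
      using sorted unfolding io xs by simp
    have so1: "p < q" if "p \<in> snd ` set ys" "q \<in> set_tree u" for p q
      using so subsetD[OF k that(1)] that(2)
      unfolding sorted_wrt_append set_append list.set set_inorder by blast
    have so2: "p < a" if "p \<in> snd ` set ys" for p
      using so subsetD[OF k that]
      unfolding sorted_wrt_append set_append list.set set_inorder by blast
    have so3: "p < a" if "p \<in> set_tree u" for p
      using so that unfolding sorted_wrt_append set_append list.set set_inorder by blast
    have so4: "a < p" if "p \<in> set (?F zs) \<union> set_tree s" for p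
      using so that unfolding sorted_wrt_append set_append list.set set_inorder by blast
    have so5: "sorted_wrt (<) (?F zs)"
      using so unfolding sorted_wrt_append by blast
    show "\<forall>x\<in>set_tree u \<union> set_tree (next_tree zs s). next_touch m P (Suc t) a \<le> next_touch m P (Suc t) x"
    proof
      fix x assume x: "x \<in> set_tree u \<union> set_tree (next_tree zs s)"
      have "\<not> (a < b \<and> b \<le> x) \<and> \<not> (x \<le> b \<and> b < a)" if b: "b \<in> P t" for b
      proof -
        consider "b \<in> snd ` set ys" | "b = a" | "b \<in> snd ` set zs" using b P_t by auto
        note b = this
        show ?thesis
        proof (cases "x \<in> set_tree u")
          case True
          have "b < x \<and> x < a \<or> a \<le> b \<and> x < a"
            using b
          proof cases
            case 1
            then show ?thesis using so1[OF 1 True] so3[OF True] by blast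
          next
            case 2
            then show ?thesis using so3[OF True] by blast
          next
            case 3
            then have "a < b" using so4 k[of zs] by blast
            then show ?thesis using so3[OF True] by simp
          qed
          then show ?thesis by auto
        next
          case False
          then have x: "x \<in> set_tree (next_tree zs s)" using x by simp
          have "x \<in> set (?F zs) \<union> set_tree s" using x by (cases zs) (auto simp: next_tree_def)
          then have "a < x" by (rule so4)
          moreover have "x < b" if zb: "b \<in> snd ` set zs"
          proof -
            obtain v c zs' where zs: "zs = (v, c) # zs'" using zb by (cases zs) auto
            have "x \<in> set_tree v" using x zs by (simp add: next_tree_def)
            moreover have "b = c \<or> b \<in> snd ` set zs'" using zb zs by auto
            then have "b = c \<or> b \<in> set (?F zs')" using k[of zs'] by blast
            moreover have "sorted_wrt (<) (inorder v @ [c] @ ?F zs')" using so5 zs by simp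
            ultimately show ?thesis
              unfolding sorted_wrt_append set_append list.set set_inorder by blast
          qed
          moreover have "b \<le> a \<or> b \<in> snd ` set zs" using b so2[of b] by cases simp_all
          ultimately show ?thesis by linarith
        qed
      qed
      then show "next_touch m P (Suc t) a \<le> next_touch m P (Suc t) x"
        using satisfied_next_touch_le[OF sat t] P_t by auto
    qed
  qed
  then obtain k' T' where T': "topcut k' xs s T'" "heap_by (next_touch m P (Suc t)) T'" by blast
  have "inorder T' = [1..<n+1]" using topcut_inorder[OF T'(1)] io T(1) by simp
  moreover have "reach (8 * card (P t)) (T, []) (P t) (T', [])"
    using topcut_exchange[OF cut T'(1)] len ks by simp
  ultimately show ?thesis using T'(2) by blast
qed

lemma heap_serve:
  assumes sat: "satisfied (length X) P"
    and P: "\<And>t. t \<in> {1..length X} \<Longrightarrow> acc X t \<in> P t \<and> P t \<subseteq> {1..n}"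
    and "1 \<le> t" "t \<le> length X + 1" "inorder T = [1..<n+1]" "heap_by (next_touch (length X) P t) T"
  shows "\<exists>opss c. serve_cost T opss (drop (t - 1) X) = Some c \<and>
    c \<le> (\<Sum>i = t..length X. 8 * card (P i) + 1)"
  using assms(3-)
proof (induction "length X + 1 - t" arbitrary: t T)
  case 0
  then show ?case by (intro exI[of _ "[]"] exI[of _ 0]) simp
next
  case (Suc d)
  then have t: "1 \<le> t" "t \<le> length X" by auto
  have P_t: "acc X t \<in> P t" "P t \<subseteq> {1..n}" using P t by auto
  obtain T' where T': "inorder T' = [1..<n+1]" "heap_by (next_touch (length X) P (Suc t)) T'"
    "reach (8 * card (P t)) (T, []) (P t) (T', [])"
    using heap_step[OF sat t P_t(2) Suc.prems(3,4)] by blast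
  have "d = length X + 1 - Suc t" using Suc.hyps(2) by simp
  from Suc.hyps(1)[OF this _ _ T'(1,2)] t
  obtain opss c where IH: "serve_cost T' opss (drop (Suc t - 1) X) = Some c"
    "c \<le> (\<Sum>i = Suc t..length X. 8 * card (P i) + 1)"
    by auto
  obtain ops sts where r: "bst_run ops (T, []) = Some sts" "last sts = (T', [])"
    "length ops \<le> 8 * card (P t)" "\<exists>u\<in>set sts. key_at u = Some (acc X t)"
    using T'(3) P_t(1) unfolding reach_def by blast
  have d: "drop (t - 1) X = acc X t # drop t X"
    using t Cons_nth_drop_Suc[of "t - 1" X] by (simp add: acc_def)
  have "serve_cost T (ops # opss) (drop (t - 1) X) = Some (length ops + 1 + c)"
    unfolding d using r IH(1) by simp
  moreover have "length ops + 1 + c \<le> (\<Sum>i = t..length X. 8 * card (P i) + 1)"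
    using r(3) IH(2) t by (simp add: sum.atLeast_Suc_atMost)
  ultimately show ?case by blast
qed

text \<open>The initial tree is free, so it can be heap-ordered from time \<open>1\<close>: list all
  keys, with a \<open>Leaf\<close> in every gap.\<close>

lemma OPT_le_satisfied:
  assumes sat: "satisfied (length X) P"
    and P: "\<And>t. t \<in> {1..length X} \<Longrightarrow> acc X t \<in> P t \<and> P t \<subseteq> {1..n}"
  shows "OPT n X \<le> (\<Sum>t = 1..length X. 8 * card (P t) + 1)"
proof -
  let ?xs = "map (\<lambda>a. (Leaf, a)) [1..<n+1] :: (nat tree \<times> nat) list"
  have "\<exists>k T. topcut k ?xs Leaf T \<and> heap_by (next_touch (length X) P 1) T"
  proof (rule topcut_heap_ex)
    fix ys u a zs assume xs: "?xs = ys @ (u, a) # zs"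
    have *: "v = Leaf" if "(v, b) \<in> set ?xs" for v b using that by auto
    have "u = Leaf" using *[of u a] unfolding xs by simp
    moreover have "next_tree zs Leaf = Leaf"
    proof (cases zs)
      case (Cons p zs')
      then show ?thesis using *[of "fst p" "snd p"] unfolding xs
        by (cases p) (simp add: next_tree_def)
    qed (simp add: next_tree_def)
    ultimately show "\<forall>x\<in>set_tree u \<union> set_tree (next_tree zs Leaf).
        next_touch (length X) P 1 a \<le> next_touch (length X) P 1 x" by simp
  qed auto
  then obtain k T where T: "topcut k ?xs Leaf T" "heap_by (next_touch (length X) P 1) T" by blast
  have io: "inorder T = [1..<n+1]"
    unfolding topcut_inorder[OF T(1)] by (simp add: comp_def concat_map_singleton del: upt_Suc)
  obtain opss c where "serve_cost T opss X = Some c" "c \<le> (\<Sum>t = 1..length X. 8 * card (P t) + 1)"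
    using heap_serve[OF sat P, where t = 1 and T = T] io T(2) by auto
  then show ?thesis unfolding OPT_def
    by (intro le_trans[OF Least_le]) (use io in \<open>auto simp: bst_on_def\<close>)
qed

section \<open>Dyadic cells\<close>

text \<open>The pair \<open>(h, j)\<close> stands for the dyadic interval \<open>[j * 2^h, (j + 1) * 2^h]\<close>.
  \<open>A t\<close> is the set of active cells before time \<open>t\<close>, and \<open>L t\<close> bounds the levels at which it
  changes. A change of a cell touches both its end points and those of its parent.\<close>

locale cell_system =
  fixes A :: "nat \<Rightarrow> (nat \<times> int) set" and L :: "nat \<Rightarrow> nat" and K :: nat and c :: int
  assumes up: "(h, j) \<in> A t \<Longrightarrow> h < K \<Longrightarrow> (Suc h, j div 2) \<in> A t"
    and level: "(h, j) \<in> A t \<Longrightarrow> h \<le> K"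
    and top: "(K, j) \<in> A t \<longleftrightarrow> j = c"
    and L_le: "L t \<le> K"
    and change: "((h, j) \<in> A t) \<noteq> ((h, j) \<in> A (Suc t)) \<Longrightarrow> h < L t"
begin

text \<open>Taking both sets makes a cell count when it appears and when it disappears.\<close>

definition C :: "nat \<Rightarrow> (nat \<times> int) set" where
  "C t = A t \<union> A (Suc t)"

definition Q :: "nat \<Rightarrow> (nat \<times> int) set" where
  "Q t = {(h, j) \<in> C t. h \<le> L t}"

definition bd :: "nat \<Rightarrow> int set" where
  "bd t = (\<Union>(h, j)\<in>Q t. {j * 2 ^ h, (j + 1) * 2 ^ h})"

lemma up_iter: "(h, j) \<in> A t \<Longrightarrow> h + k \<le> K \<Longrightarrow> (h + k, j div 2 ^ k) \<in> A t"
proof (induction k)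
  case (Suc k)
  then have "(Suc (h + k), j div 2 ^ k div 2) \<in> A t" by (intro up) auto
  moreover have "j div 2 ^ k div 2 = j div 2 ^ Suc k"
    by (simp add: zdiv_zmult2_eq[symmetric] mult.commute)
  ultimately show ?case by simp
qed simp

lemma C_up_iter: "(h, j) \<in> C t \<Longrightarrow> h + k \<le> K \<Longrightarrow> (h + k, j div 2 ^ k) \<in> C t"
  unfolding C_def using up_iter by auto

lemma bdI: "(h, j) \<in> C t \<Longrightarrow> h \<le> L t \<Longrightarrow> j * 2 ^ h \<in> bd t \<and> (j + 1) * 2 ^ h \<in> bd t"
  unfolding bd_def Q_def by auto

lemma cell_subset_iter:
  fixes j :: int
  shows "j div 2 ^ k * 2 ^ (h + k) \<le> j * 2 ^ h \<and> (j + 1) * 2 ^ h \<le> (j div 2 ^ k + 1) * 2 ^ (h + k)"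
proof
  have *: "j = j div 2 ^ k * 2 ^ k + j mod 2 ^ k" by (rule div_mult_mod_eq[symmetric])
  have m: "0 \<le> j mod 2 ^ k" "j mod 2 ^ k < 2 ^ k" by simp_all
  have "j div 2 ^ k * 2 ^ k \<le> j" using * m by linarith
  then have "j div 2 ^ k * 2 ^ k * 2 ^ h \<le> j * 2 ^ h" by (rule mult_right_mono) simp
  then show "j div 2 ^ k * 2 ^ (h + k) \<le> j * 2 ^ h" by (simp add: power_add ac_simps)
  have "j + 1 \<le> (j div 2 ^ k + 1) * 2 ^ k" using * m by (simp only: distrib_right)
  then have "(j + 1) * 2 ^ h \<le> (j div 2 ^ k + 1) * 2 ^ k * 2 ^ h" by (intro mult_right_mono) simp_all
  then show "(j + 1) * 2 ^ h \<le> (j div 2 ^ k + 1) * 2 ^ (h + k)" by (simp add: power_add ac_simps)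
qed

lemma cell_unique:
  fixes z :: int
  assumes "k * z < a" "a < (k + 1) * z" "v * z \<le> a" "a \<le> (v + 1) * z" "z > 0"
  shows "v = k"
proof -
  have "v * z < (k + 1) * z" "k * z < (v + 1) * z" using assms by linarith+
  then show ?thesis using assms(5) by (simp add: mult_less_cancel_right)
qed

lemma no_multiple_between:
  fixes z :: int
  assumes "k * z < q * z" "q * z < (k + 1) * z" "z > 0"
  shows False
  using assms by (simp add: mult_less_cancel_right)

text \<open>Suppose \<open>a\<close> is not touched again. If the cell ending at \<open>g\<close> is
  in \<open>C t\<close>, it lies above level \<open>L t\<close>, and then \<open>g\<close> cannot be
  interior to a cell of that level. Otherwise an ancestor \<open>(i, u)\<close> of it with parent in
  \<open>C t\<close> is created at some time \<open>w\<close>. For \<open>i < L t\<close>, time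
  \<open>w\<close> touches the left end and the midpoint of the parent, so \<open>a\<close> is
  interior to one half. That half is the sibling of \<open>u\<close>, with ends touched at
  \<open>t\<close>: either the midpoint blocks the way from \<open>a\<close> to \<open>g\<close>, or
  \<open>g\<close> lies left of \<open>a\<close>.\<close>

lemma bd_guard:
  assumes t: "t < t'" and a: "a \<in> bd t" and g: "g \<in> bd t'" and ag: "a < g"
    and free: "\<And>v b. t \<le> v \<Longrightarrow> v < t' \<Longrightarrow> b \<in> bd v \<Longrightarrow> \<not> (a < b \<and> b \<le> g)"
  shows "\<exists>v\<in>{t<..t'}. a \<in> bd v"
proof (rule ccontr)
  assume "\<not> ?thesis"
  then have un: "a \<notin> bd v" if "t < v" "v \<le> t'" for v using that by auto
  define p where "p = L t"
  obtain h j where J: "(h, j) \<in> C t" "h \<le> p" "a = j * 2 ^ h \<or> a = (j + 1) * 2 ^ h"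
    using a unfolding bd_def Q_def p_def by auto
  obtain h' j' where J': "(h', j') \<in> C t'" "h' \<le> L t'" "g = j' * 2 ^ h' \<or> g = (j' + 1) * 2 ^ h'"
    using g unfolding bd_def Q_def by auto
  have jlt: "j * 2 ^ h < (j + 1) * 2 ^ h" "j' * 2 ^ h' < (j' + 1) * 2 ^ h'" by simp_all
  have free_t: "b \<le> a \<or> g < b" if "b \<in> bd t" for b using free[of t b] t that by auto
  have anc: "(i, j div 2 ^ (i - h)) \<in> C t \<and>
      j div 2 ^ (i - h) * 2 ^ i \<le> a \<and> a \<le> (j div 2 ^ (i - h) + 1) * 2 ^ i"
    if "h \<le> i" "i \<le> K" for i
  proof -
    have "j * 2 ^ h \<le> a" "a \<le> (j + 1) * 2 ^ h" using J(3) jlt(1) by linarith+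
    then show ?thesis
      using C_up_iter[OF J(1), of "i - h"] cell_subset_iter[of j "i - h" h] that
      by (auto intro: order_trans)
  qed
  define e where "e = j div 2 ^ (p - h)"
  have e: "(p, e) \<in> C t" "e * 2 ^ p \<le> a" "a \<le> (e + 1) * 2 ^ p"
    using anc[of p] J(2) L_le[of t] unfolding e_def p_def by auto
  \<comment> \<open>If \<open>a\<close> is the right end of the level-\<open>p\<close> ancestor, that cell stays active, at a level above
    all later changes; otherwise \<open>g\<close> is interior to it.\<close>
  have key: "(e * 2 ^ p < g \<and> g < (e + 1) * 2 ^ p) \<or> (\<forall>v. t < v \<and> v \<le> t' \<longrightarrow> L v < p)"
  proof (cases "a = (e + 1) * 2 ^ p")
    case True
    \<comment> \<open>The bound in \<open>change\<close> is strict, so nothing changes at level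
      \<open>L t\<close> itself.\<close>
    have "(p, e) \<in> A (Suc t)"
      using change[of p e t] e(1) unfolding C_def p_def by blast
    have "(p, e) \<in> A (Suc t + d) \<and> L (Suc t + d) < p" if "Suc t + d \<le> t'" for d
      using that
    proof (induction d)
      case 0
      have "a \<notin> bd (Suc t)" using un 0 by simp
      then show ?case using \<open>(p, e) \<in> A (Suc t)\<close> bdI[of p e "Suc t"] True
        unfolding C_def by force
    next
      case (Suc d)
      then have IH: "(p, e) \<in> A (Suc t + d)" "L (Suc t + d) < p" by auto
      then have "(p, e) \<in> A (Suc t + Suc d)" using change[of p e "Suc t + d"] by force
      moreover have "a \<notin> bd (Suc t + Suc d)" using un Suc.prems by simp
      ultimately show ?case using bdI[of p e "Suc t + Suc d"] True unfolding C_def by force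
    qed
    note stay = this
    have "L v < p" if "t < v" "v \<le> t'" for v
      using stay[of "v - Suc t"] that by simp
    then show ?thesis by blast
  next
    case False
    then have "a < (e + 1) * 2 ^ p" using e by simp
    moreover have "(e + 1) * 2 ^ p \<in> bd t" using bdI[of p e t] e(1) p_def by simp
    ultimately have "g < (e + 1) * 2 ^ p" using free_t by fastforce
    then show ?thesis using e(2) ag by simp
  qed
  show False
  proof (cases "(h', j') \<in> C t")
    case True
    have "p < h'"
    proof (rule ccontr)
      assume "\<not> p < h'"
      then have "g \<in> bd t" using bdI[OF True] J'(3) unfolding p_def by auto
      then show False using free_t ag by fastforce
    qed
    then have "e * 2 ^ p < g \<and> g < (e + 1) * 2 ^ p" using key J'(2) t by fastforce
    moreover obtain q where "g = q * 2 ^ p"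
    proof -
      have *: "(2::int) ^ h' = 2 ^ (h' - p) * 2 ^ p" using \<open>p < h'\<close> by (simp flip: power_add)
      show thesis using J'(3) that unfolding * mult.assoc[symmetric] by blast
    qed
    ultimately show False using no_multiple_between[of e "2 ^ p" q] by simp
  next
    case False
    \<comment> \<open>Climb to the lowest ancestor in \<open>C t\<close>, which exists because the
      top cell is always active; \<open>(i, u)\<close> is the cell just below it.\<close>
    define R where "R k \<longleftrightarrow> (h' + k, j' div 2 ^ k) \<in> C t" for k
    have h'K: "h' \<le> K" using J'(1) level unfolding C_def by blast
    then have "(K, j' div 2 ^ (K - h')) \<in> C t'" using C_up_iter[OF J'(1), of "K - h'"] by simp
    then have RK: "R (K - h')" using top h'K unfolding R_def C_def by auto
    have "\<not> R 0" using False by (simp add: R_def)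
    then obtain k where k: "k < K - h'" "\<not> R k" "R (Suc k)"
      using ex_least_nat_less[of R "K - h'"] RK by auto
    define i where "i = h' + k"
    define u where "u = j' div 2 ^ k"
    have iK: "i < K" using k(1) unfolding i_def by simp
    have I: "(i, u) \<notin> C t" "(i, u) \<in> C t'"
      using k(2) C_up_iter[OF J'(1), of k] iK unfolding R_def i_def u_def by auto
    have par: "(Suc i, u div 2) \<in> C t"
      using k(3) unfolding R_def i_def u_def
      by (simp add: zdiv_zmult2_eq[symmetric] mult.commute)
    have gI: "u * 2 ^ i \<le> g" "g \<le> (u + 1) * 2 ^ i"
    proof -
      have "j' * 2 ^ h' \<le> g" "g \<le> (j' + 1) * 2 ^ h'" using J'(3) jlt(2) by linarith+
      then show "u * 2 ^ i \<le> g" "g \<le> (u + 1) * 2 ^ i"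
        using cell_subset_iter[of j' k h'] unfolding i_def u_def by (auto intro: order_trans)
    qed
    have "\<exists>w. t < w \<and> w \<le> t' \<and> (i, u) \<notin> A w \<and> (i, u) \<in> A (Suc w)"
    proof (rule ccontr)
      assume no: "\<not> ?thesis"
      have "(i, u) \<notin> A (Suc t + d)" if "Suc t + d \<le> Suc t'" for d
        using that
      proof (induction d)
        case 0
        then show ?case using I(1) unfolding C_def by simp
      next
        case (Suc d)
        then show ?case using no[simplified, rule_format, of "Suc t + d"] by auto
      qed
      from this[of "t' - t"] this[of "t' - Suc t"] show False
        using I(2) t unfolding C_def by auto
    qed
    then obtain w where w: "t < w" "w \<le> t'" "(i, u) \<notin> A w" "(i, u) \<in> A (Suc w)" by blast
    have iL: "i < L w" using change[of i u w] w by blast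
    show False
    proof (cases "i < p")
      case False
      \<comment> \<open>Here \<open>g\<close> is interior to a cell of \<open>C t\<close> at level
        \<open>i\<close>, and no other cell of that level contains it.\<close>
      have "\<not> L w < p" using False iL by simp
      then have gi: "e * 2 ^ p < g" "g < (e + 1) * 2 ^ p" using key w by auto
      define v where "v = e div 2 ^ (i - p)"
      have v: "(i, v) \<in> C t" using C_up_iter[OF e(1), of "i - p"] False iK unfolding v_def by simp
      have "v * 2 ^ i < g" "g < (v + 1) * 2 ^ i"
        using cell_subset_iter[of e "i - p" p] gi False unfolding v_def by auto
      then have "u = v" using gI by (intro cell_unique[of v "2 ^ i" g u]) auto
      then show False using v I(1) by simp
    next
      case True
      define U where "U = u div 2"
      define z :: int where "z = 2 ^ i"
      have z: "z > 0" by (simp add: z_def)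
      have uU: "u = 2 * U \<or> u = 2 * U + 1" unfolding U_def by linarith
      have parz: "U * 2 ^ Suc i = 2 * U * z" "(U + 1) * 2 ^ Suc i = (2 * U + 2) * z"
        unfolding z_def by (simp_all add: algebra_simps)
      have par_t: "2 * U * z \<in> bd t" "(2 * U + 2) * z \<in> bd t"
        using bdI[OF par[folded U_def]] True unfolding p_def parz by auto
      have "(Suc i, U) \<in> A (Suc w)" unfolding U_def using up[OF w(4)] iK by simp
      then have par_w: "2 * U * z \<in> bd w"
        using bdI[of "Suc i" U w] iL unfolding parz C_def by auto
      have "u * z \<in> bd w \<and> (u + 1) * z \<in> bd w"
        using bdI[of i u w] iL w(4) unfolding z_def C_def by auto
      then have "(2 * U + 1) * z \<in> bd w" using uU by auto
      then have aM: "a \<noteq> (2 * U + 1) * z" "a \<noteq> 2 * U * z" using un[OF w(1,2)] par_w by auto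
      have gz: "u * z \<le> g" "g \<le> (u + 1) * z" using gI by (simp_all add: z_def)
      have uz: "2 * U * z \<le> u * z" "(u + 1) * z \<le> (2 * U + 2) * z"
        using uU z by (auto intro!: mult_right_mono)
      have in_par: "2 * U * z < a" "a < (2 * U + 2) * z"
        using free_t[OF par_t(1)] gz uz aM ag by linarith+
      \<comment> \<open>The ends of a cell above level \<open>i\<close> are multiples of
        \<open>2 ^ Suc i\<close>, none of which is interior to the parent.\<close>
      have "h \<le> i"
      proof (rule ccontr)
        assume "\<not> h \<le> i"
        then have *: "(2::int) ^ h = 2 ^ (h - Suc i) * 2 ^ Suc i" by (simp del: power_Suc flip: power_add)
        obtain q where "a = q * 2 ^ Suc i" using J(3) unfolding * mult.assoc[symmetric] by blast
        then show False
          using no_multiple_between[of U "2 ^ Suc i" q] in_par unfolding parz by simp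
      qed
      define v where "v = j div 2 ^ (i - h)"
      have v: "(i, v) \<in> C t" "v * z \<le> a" "a \<le> (v + 1) * z"
        using anc[OF \<open>h \<le> i\<close>] iK unfolding v_def z_def by auto
      have vt: "v * z \<in> bd t \<and> (v + 1) * z \<in> bd t"
        using bdI[OF v(1)] True unfolding z_def p_def by auto
      have "v \<noteq> u" using v(1) I(1) by auto
      consider "a < (2 * U + 1) * z" | "(2 * U + 1) * z < a" using aM by linarith
      then show False
      proof cases
        case 1
        then have "v = 2 * U"
          using in_par v z by (intro cell_unique[of "2 * U" z a v]) auto
        moreover then have "u = 2 * U + 1" using uU \<open>v \<noteq> u\<close> by auto
        ultimately have "(2 * U + 1) * z \<in> bd t" "(2 * U + 1) * z \<le> g" using vt gz by auto
        then show False using free_t 1 by fastforce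
      next
        case 2
        have "a < (2 * U + 1 + 1) * z" using in_par(2) by (simp add: add.assoc)
        then have "v = 2 * U + 1"
          using 2 v z by (intro cell_unique[of "2 * U + 1" z a v]) auto
        then have "u = 2 * U" using uU \<open>v \<noteq> u\<close> by auto
        then show False using gz(2) 2 ag by simp
      qed
    qed
  qed
qed

text \<open>Negating points sends cell \<open>j\<close> to cell \<open>- 1 - j\<close>, which yields
  the case \<open>g < a\<close> from \<open>bd_guard\<close>. Integer indices and a variable top
  cell \<open>c\<close> make the locale closed under this reflection.\<close>

lemma mirror: "cell_system (\<lambda>t. {(h, j). (h, - 1 - j) \<in> A t}) L K (- 1 - c)"
proof
  show "(Suc h, j div 2) \<in> {(h, j). (h, - 1 - j) \<in> A t}"
    if "(h, j) \<in> {(h, j). (h, - 1 - j) \<in> A t}" "h < K" for h j t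
  proof -
    have "(- 1 - j) div 2 = - 1 - j div 2" by presburger
    then show ?thesis using up[of h "- 1 - j" t] that by simp
  qed
  show "(K, j) \<in> {(h, j). (h, - 1 - j) \<in> A t} \<longleftrightarrow> j = - 1 - c" for j t
    using top[of "- 1 - j" t] by auto
qed (use level L_le change in auto)

lemma bd_guard_mirror:
  assumes t: "t < t'" and a: "a \<in> bd t" and g: "g \<in> bd t'" and ag: "g < a"
    and free: "\<And>v b. t \<le> v \<Longrightarrow> v < t' \<Longrightarrow> b \<in> bd v \<Longrightarrow> \<not> (g \<le> b \<and> b < a)"
  shows "\<exists>v\<in>{t<..t'}. a \<in> bd v"
proof -
  interpret m: cell_system "\<lambda>t. {(h, j). (h, - 1 - j) \<in> A t}" L K "- 1 - c" by (rule mirror)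
  have 1: "- b \<in> bd t" if b: "b \<in> m.bd t" for b t
  proof -
    obtain h j where hj: "(h, j) \<in> m.C t" "h \<le> L t" "b = j * 2 ^ h \<or> b = (j + 1) * 2 ^ h"
      using b unfolding m.bd_def m.Q_def by auto
    moreover have "(h, - 1 - j) \<in> C t" using hj(1) unfolding m.C_def C_def by auto
    moreover from this hj(2) bdI[of h "- 1 - j" t]
    have "(- 1 - j) * 2 ^ h \<in> bd t" "(- 1 - j + 1) * 2 ^ h \<in> bd t" by auto
    ultimately show ?thesis by (auto simp: algebra_simps)
  qed
  have 2: "- b \<in> m.bd t" if b: "b \<in> bd t" for b t
  proof -
    obtain h j where hj: "(h, j) \<in> C t" "h \<le> L t" "b = j * 2 ^ h \<or> b = (j + 1) * 2 ^ h"
      using b unfolding bd_def Q_def by auto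
    moreover have "(h, - 1 - j) \<in> m.C t" using hj(1) unfolding m.C_def C_def by auto
    moreover from this hj(2) m.bdI[of h "- 1 - j" t]
    have "(- 1 - j) * 2 ^ h \<in> m.bd t" "(- 1 - j + 1) * 2 ^ h \<in> m.bd t" by auto
    ultimately show ?thesis by (auto simp: algebra_simps)
  qed
  have "\<exists>v\<in>{t<..t'}. - a \<in> m.bd v"
  proof (rule m.bd_guard[OF t 2[OF a] 2[OF g]])
    show "- a < - g" using ag by simp
    fix v b assume "t \<le> v" "v < t'" "b \<in> m.bd v"
    then show "\<not> (- a < b \<and> b \<le> - g)" using free[of v "- b"] 1[of b v] by auto
  qed
  then show ?thesis using 1 by fastforce
qed

end

section \<open>Cells of a sliding window of accesses\<close>

definition ancestors :: "nat \<Rightarrow> int \<Rightarrow> (nat \<times> int) set" where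
  "ancestors K z = (\<lambda>h. (h, z div 2 ^ h)) ` {..K}"

text \<open>Truncated subtraction lets early windows reach back to a fictitious access at time
  \<open>0\<close>, so no window is empty for positive \<open>l\<close>.\<close>

definition window_cells :: "nat \<Rightarrow> nat \<Rightarrow> (nat \<Rightarrow> int) \<Rightarrow> nat \<Rightarrow> (nat \<times> int) set" where
  "window_cells K l y t = (\<Union>s\<in>{t - l..t - 1}. ancestors K (y s))"

lemma div_pow_Suc: "z div 2 ^ h div 2 = z div (2::int) ^ Suc h"
  by (simp add: zdiv_zmult2_eq[symmetric] mult.commute)

lemma card_ancestors: "card (ancestors K z) = K + 1"
  unfolding ancestors_def by (subst card_image) (auto intro: inj_onI)

text \<open>As \<open>B\<close> is closed upwards, the levels missing from it form an initial
  segment, so their number exceeds each of them.\<close>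

lemma ancestors_diff_levels:
  assumes up: "\<And>h j. (h, j) \<in> B \<Longrightarrow> h < K \<Longrightarrow> (Suc h, j div 2) \<in> B"
    and top: "(K, z div 2 ^ K) \<in> B"
  shows "card (ancestors K z - B) \<le> K \<and> (\<forall>(h, j)\<in>ancestors K z - B. h < card (ancestors K z - B))"
proof -
  have fin: "finite (ancestors K z - B)" by (simp add: ancestors_def)
  have inj: "inj_on fst (ancestors K z - B)" unfolding ancestors_def by (auto intro: inj_onI)
  have "fst ` (ancestors K z - B) \<subseteq> {..<K}"
  proof
    fix h assume "h \<in> fst ` (ancestors K z - B)"
    then have "h \<le> K" "(h, z div 2 ^ h) \<notin> B" unfolding ancestors_def by auto
    then show "h \<in> {..<K}" using top by (cases "h = K") auto
  qed
  from card_mono[OF _ this] have "card (ancestors K z - B) \<le> K" using card_image[OF inj] by simp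
  moreover have "h < card (ancestors K z - B)" if "(h, j) \<in> ancestors K z - B" for h j
  proof -
    have h: "h \<le> K" "(h, z div 2 ^ h) \<notin> B" using that unfolding ancestors_def by auto
    have "(h - d, z div 2 ^ (h - d)) \<notin> B" if "d \<le> h" for d
      using that
    proof (induction d)
      case (Suc d)
      then have "Suc (h - Suc d) = h - d" by simp
      then have "(Suc (h - Suc d), z div 2 ^ (h - Suc d) div 2) \<notin> B"
        using Suc by (simp only: div_pow_Suc) simp
      then show ?case using up h(1) Suc.prems by fastforce
    qed (use h in simp)
    note low = this
    have "(i, z div 2 ^ i) \<in> ancestors K z - B" if "i \<le> h" for i
      using low[of "h - i"] that h(1) unfolding ancestors_def by auto
    then have "(\<lambda>i. (i, z div 2 ^ i)) ` {..h} \<subseteq> ancestors K z - B" by auto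
    from card_mono[OF fin this] have "Suc h \<le> card (ancestors K z - B)"
      by (subst (asm) card_image) (auto intro: inj_onI)
    then show ?thesis by simp
  qed
  ultimately show ?thesis by blast
qed

locale window_system =
  fixes K l :: nat and y :: "nat \<Rightarrow> int"
  assumes l: "1 \<le> l" and y: "0 \<le> y s" "y s < 2 ^ K"
begin

abbreviation A :: "nat \<Rightarrow> (nat \<times> int) set" where
  "A \<equiv> window_cells K l y"

definition new :: "nat \<Rightarrow> nat" where "new t = card (A (Suc t) - A t)"
definition old :: "nat \<Rightarrow> nat" where "old t = card (A t - A (Suc t))"
text \<open>Cardinalities bound the changing levels by \<open>ancestors_diff_levels\<close> and,
  unlike the levels themselves, can be amortized.\<close>

definition L :: "nat \<Rightarrow> nat" where "L t = max (new t) (old t)"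

lemma A_up: "(h, j) \<in> A t \<Longrightarrow> h < K \<Longrightarrow> (Suc h, j div 2) \<in> A t"
  unfolding window_cells_def ancestors_def using div_pow_Suc by fastforce

lemma A_top: "(K, j) \<in> A t \<longleftrightarrow> j = 0"
proof -
  have "t - 1 \<in> {t - l..t - 1}" using l by simp
  moreover have "y s div 2 ^ K = 0" for s using y by (intro div_pos_pos_trivial) auto
  ultimately show ?thesis unfolding window_cells_def ancestors_def by fastforce
qed

lemma top_mem: "(K, y s div 2 ^ K) \<in> A t"
  using A_top y by (simp add: div_pos_pos_trivial)

lemma new_cells: "A (Suc t) - A t = ancestors K (y t) - A t"
proof -
  have "{Suc t - l..Suc t - 1} \<subseteq> insert t {t - l..t - 1}" "t \<in> {Suc t - l..Suc t - 1}" using l by auto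
  then show ?thesis unfolding window_cells_def by blast
qed

lemma old_cells: "A t - A (Suc t) = ancestors K (y (t - l)) - A (Suc t)"
proof -
  have "{t - l..t - 1} \<subseteq> insert (t - l) {Suc t - l..Suc t - 1}" "t - l \<in> {t - l..t - 1}" using l by auto
  then show ?thesis unfolding window_cells_def by blast
qed

sublocale cell_system A L K 0
proof
  fix t
  note N = ancestors_diff_levels[OF A_up top_mem, of t t, folded new_cells, folded new_def]
  note O = ancestors_diff_levels[OF A_up top_mem, of "Suc t" "t - l", folded old_cells, folded old_def]
  show "L t \<le> K" using N O by (simp add: L_def)
  show "h < L t" if "((h, j) \<in> A t) \<noteq> ((h, j) \<in> A (Suc t))" for h j
  proof (cases "(h, j) \<in> A t")
    case True
    then have "(h, j) \<in> A t - A (Suc t)" using that by auto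
    then have "h < old t" using O by blast
    then show ?thesis by (simp add: L_def)
  next
    case False
    then have "(h, j) \<in> A (Suc t) - A t" using that by auto
    then have "h < new t" using N by blast
    then show ?thesis by (simp add: L_def)
  qed
qed (use A_up A_top in \<open>auto simp: window_cells_def ancestors_def\<close>)

lemma finite_A: "finite (A t)"
  by (simp add: window_cells_def ancestors_def)

text \<open>A departing cell has either arrived earlier or is one of the \<open>K + 1\<close> cells
  of \<open>A 1\<close>.\<close>

lemma sum_old_le: "(\<Sum>t = 1..m. old t) \<le> (\<Sum>t = 1..m. new t) + (K + 1)"
proof -
  have step: "card (A t) + new t = card (A (Suc t)) + old t" for t
  proof -
    have "card (A t) + new t = card (A t \<union> (A (Suc t) - A t))"
      unfolding new_def by (subst card_Un_disjoint) (auto simp: finite_A)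
    also have "A t \<union> (A (Suc t) - A t) = A (Suc t) \<union> (A t - A (Suc t))" by auto
    also have "card \<dots> = card (A (Suc t)) + old t"
      unfolding old_def by (subst card_Un_disjoint) (auto simp: finite_A)
    finally show ?thesis .
  qed
  have "card (A (Suc m)) + (\<Sum>t = 1..m. old t) = (\<Sum>t = 1..m. new t) + card (A 1)"
  proof (induction m)
    case (Suc m)
    then show ?case using step[of "Suc m"] by simp
  qed simp
  moreover have "A 1 = ancestors K (y 0)" using l by (simp add: window_cells_def)
  ultimately show ?thesis by (simp add: card_ancestors)
qed

text \<open>Each level holds at most \<open>l + 1\<close> cells of \<open>C t\<close>, the ancestors
  of the points of times \<open>t - l\<close> to \<open>t\<close>, and each cell has two
  ends.\<close>

lemma finite_bd_card: "finite (bd t) \<and> card (bd t) \<le> 2 * (l + 1) * (L t + 1)"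
proof -
  have "Q t \<subseteq> (\<lambda>(s, h). (h, y s div 2 ^ h)) ` ({t - l..t} \<times> {..L t})" (is "_ \<subseteq> ?f ` ?S")
  proof
    fix x assume "x \<in> Q t"
    then obtain h s where hs: "x = (h, y s div 2 ^ h)" "h \<le> L t"
      "s \<in> {t - l..t - 1} \<union> {Suc t - l..Suc t - 1}"
      unfolding Q_def C_def window_cells_def ancestors_def by auto
    then have "(s, h) \<in> ?S" by auto
    then show "x \<in> ?f ` ?S" using hs(1) by (intro image_eqI[of _ _ "(s, h)"]) auto
  qed
  moreover have "card ?S \<le> (l + 1) * (L t + 1)"
    unfolding card_cartesian_product by (rule mult_le_mono) auto
  ultimately have Q: "finite (Q t)" "card (Q t) \<le> (l + 1) * (L t + 1)"
    using surj_card_le[of ?S "Q t" ?f] finite_subset[of "Q t" "?f ` ?S"] by auto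
  have two: "card (case x of (h, j) \<Rightarrow> {j * 2 ^ h, (j + 1) * 2 ^ h}) \<le> 2" for x :: "nat \<times> int"
    by (cases x) (simp add: card_insert_if)
  have "card (bd t) \<le> (\<Sum>x\<in>Q t. card (case x of (h, j) \<Rightarrow> {j * 2 ^ h, (j + 1) * 2 ^ h}))"
    unfolding bd_def by (rule card_UN_le[OF Q(1)])
  also have "\<dots> \<le> (\<Sum>x\<in>Q t. 2)" by (rule sum_mono) (rule two)
  finally show ?thesis using Q by (auto simp: bd_def)
qed

lemma y_mem_bd: "y t \<in> bd t"
proof -
  have "(0, y t) \<in> A (Suc t)" using l unfolding window_cells_def ancestors_def
    by (auto intro!: bexI[of _ t] image_eqI[of _ _ 0])
  then show ?thesis using bdI[of 0 "y t" t] unfolding C_def by simp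
qed

lemma new_le:
  assumes "u \<in> {t - l..t - 1}"
  shows "new t \<le> card {h\<in>{..K}. y t div 2 ^ h \<noteq> y u div 2 ^ h}"
proof -
  have "A (Suc t) - A t \<subseteq> (\<lambda>h. (h, y t div 2 ^ h)) ` {h\<in>{..K}. y t div 2 ^ h \<noteq> y u div 2 ^ h}"
  proof
    fix x assume "x \<in> A (Suc t) - A t"
    then obtain h where h: "x = (h, y t div 2 ^ h)" "h \<le> K" "x \<notin> A t"
      unfolding new_cells by (auto simp: ancestors_def)
    moreover have "(h, y u div 2 ^ h) \<in> A t"
      using assms h(2) by (auto simp: window_cells_def ancestors_def)
    ultimately show "x \<in> (\<lambda>h. (h, y t div 2 ^ h)) ` {h\<in>{..K}. y t div 2 ^ h \<noteq> y u div 2 ^ h}" by auto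
  qed
  then show ?thesis unfolding new_def by (intro surj_card_le) auto
qed

definition touched :: "nat \<Rightarrow> nat \<Rightarrow> nat \<Rightarrow> nat set" where
  "touched n \<sigma> t = {b\<in>{1..n}. int b + int \<sigma> \<in> bd t}"

lemma card_touched: "card (touched n \<sigma> t) \<le> 2 * (l + 1) * (L t + 1)"
proof -
  have "card (touched n \<sigma> t) \<le> card (bd t)"
    by (rule card_inj_on_le[of "\<lambda>b. int b + int \<sigma>"])
       (auto simp: touched_def finite_bd_card intro: inj_onI)
  then show ?thesis using finite_bd_card[of t] by linarith
qed

text \<open>Discarding end points that are not shifted keys is harmless, since every integer between
  two shifted keys is a shifted key.\<close>

lemma satisfied_touched: "satisfied m (touched n \<sigma>)"
  unfolding satisfied_def
proof (intro allI impI)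
  fix t t' a g
  assume tt: "t < t'" and a: "a \<in> touched n \<sigma> t" and g: "g \<in> touched n \<sigma> t'"
    and free: "\<forall>v\<in>{t..<t'}. \<forall>b\<in>touched n \<sigma> v. \<not> (a < b \<and> b \<le> g) \<and> \<not> (g \<le> b \<and> b < a)"
  let ?f = "\<lambda>b. int b + int \<sigma>"
  have ab: "?f a \<in> bd t" "?f g \<in> bd t'" "a \<in> {1..n}" "g \<in> {1..n}" using a g by (auto simp: touched_def)
  have pre: "nat (b - int \<sigma>) \<in> touched n \<sigma> v \<and> ?f (nat (b - int \<sigma>)) = b"
    if "b \<in> bd v" "?f a \<le> b \<and> b \<le> ?f g \<or> ?f g \<le> b \<and> b \<le> ?f a" for b v
    using that ab(3,4) by (auto simp: touched_def)
  have "\<exists>v\<in>{t<..t'}. ?f a \<in> bd v"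
  proof (cases a g rule: linorder_cases)
    case less
    show ?thesis
    proof (rule bd_guard[OF tt ab(1,2)])
      fix v b assume v: "t \<le> v" "v < t'" "b \<in> bd v"
      show "\<not> (?f a < b \<and> b \<le> ?f g)"
      proof
        assume "?f a < b \<and> b \<le> ?f g"
        moreover from this pre[OF v(3)] have "nat (b - int \<sigma>) \<in> touched n \<sigma> v" "?f (nat (b - int \<sigma>)) = b"
          by auto
        ultimately show False using bspec[OF bspec[OF free, of v], of "nat (b - int \<sigma>)"] v by auto
      qed
    qed (use less in auto)
  next
    case equal
    then show ?thesis using ab(2) tt by auto
  next
    case greater
    show ?thesis
    proof (rule bd_guard_mirror[OF tt ab(1,2)])
      fix v b assume v: "t \<le> v" "v < t'" "b \<in> bd v"
      show "\<not> (?f g \<le> b \<and> b < ?f a)"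
      proof
        assume "?f g \<le> b \<and> b < ?f a"
        moreover from this pre[OF v(3)] have "nat (b - int \<sigma>) \<in> touched n \<sigma> v" "?f (nat (b - int \<sigma>)) = b"
          by auto
        ultimately show False using bspec[OF bspec[OF free, of v], of "nat (b - int \<sigma>)"] v by auto
      qed
    qed (use greater in auto)
  qed
  then show "\<exists>v\<in>{t<..t'}. a \<in> touched n \<sigma> v" using ab(3) by (auto simp: touched_def)
qed

end

section \<open>Averaging over shifts\<close>

text \<open>These shifts agree modulo \<open>2 ^ h\<close>, so the quotient determines them.\<close>

lemma card_shift_dvd:
  fixes c :: int
  assumes "h \<le> k"
  shows "card {\<sigma>\<in>{..<2 ^ k :: nat}. 2 ^ h dvd c + int \<sigma>} \<le> 2 ^ (k - h)"
proof -
  let ?S = "{\<sigma>\<in>{..<2 ^ k :: nat}. 2 ^ h dvd c + int \<sigma>}"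
  have "inj_on (\<lambda>\<sigma>. \<sigma> div 2 ^ h) ?S"
  proof (rule inj_onI)
    fix a b assume a: "a \<in> ?S" and b: "b \<in> ?S" and d: "a div 2 ^ h = b div 2 ^ h"
    have "2 ^ h dvd (c + int a) - (c + int b)" using a b by (intro dvd_diff) auto
    then have "int a mod 2 ^ h = int b mod 2 ^ h" by (simp add: mod_eq_dvd_iff)
    then have "int (a mod 2 ^ h) = int (b mod 2 ^ h)" by (simp add: zmod_int)
    then show "a = b" using d by (metis div_mult_mod_eq of_nat_eq_iff)
  qed
  moreover have "(\<lambda>\<sigma>. \<sigma> div 2 ^ h) ` ?S \<subseteq> {..<2 ^ (k - h)}"
  proof -
    have "a div 2 ^ h < 2 ^ (k - h)" if "a < 2 ^ k" for a :: nat
      using that assms by (intro less_mult_imp_div_less) (simp flip: power_add)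
    then show ?thesis by auto
  qed
  ultimately have "card ?S \<le> card {..<2 ^ (k - h) :: nat}" by (rule card_inj_on_le) simp
  then show ?thesis by simp
qed

text \<open>Separated points have a multiple of \<open>2 ^ h\<close> between them; sum over its
  possible distances \<open>i\<close> from the smaller point.\<close>

lemma card_separating_shifts:
  fixes x x' :: int
  assumes "h \<le> k"
  shows "card {\<sigma>\<in>{..<2 ^ k :: nat}. (x + int \<sigma>) div 2 ^ h \<noteq> (x' + int \<sigma>) div 2 ^ h}
    \<le> nat \<bar>x - x'\<bar> * 2 ^ (k - h)"
proof (induction x x' rule: linorder_wlog)
  case (le x x')
  let ?D = "\<lambda>i. {\<sigma>\<in>{..<2 ^ k :: nat}. 2 ^ h dvd x + int i + int \<sigma>}"
  have "{\<sigma>\<in>{..<2 ^ k :: nat}. (x + int \<sigma>) div 2 ^ h \<noteq> (x' + int \<sigma>) div 2 ^ h}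
      \<subseteq> (\<Union>i\<in>{1..nat (x' - x)}. ?D i)"
  proof
    fix \<sigma> assume s: "\<sigma> \<in> {\<sigma>\<in>{..<2 ^ k :: nat}. (x + int \<sigma>) div 2 ^ h \<noteq> (x' + int \<sigma>) div 2 ^ h}"
    define q where "q = (x' + int \<sigma>) div 2 ^ h"
    have "(x + int \<sigma>) div 2 ^ h \<le> q" unfolding q_def using le by (intro zdiv_mono1) auto
    then have "(x + int \<sigma>) div 2 ^ h < q" using s unfolding q_def by auto
    then have 1: "x + int \<sigma> < q * 2 ^ h"
      using zdiv_mono1[of "q * 2 ^ h" "x + int \<sigma>" "2 ^ h"] by fastforce
    have 2: "q * 2 ^ h \<le> x' + int \<sigma>" unfolding q_def
      by (metis div_mult_mod_eq le_add_same_cancel1 pos_mod_sign zero_less_numeral zero_less_power)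
    define i where "i = nat (q * 2 ^ h - (x + int \<sigma>))"
    have "int i = q * 2 ^ h - (x + int \<sigma>)" using 1 by (simp add: i_def)
    then have "x + int i + int \<sigma> = q * 2 ^ h" by simp
    then have "\<sigma> \<in> ?D i" using s by simp
    moreover have "i \<in> {1..nat (x' - x)}" using 1 2 unfolding i_def by auto
    ultimately show "\<sigma> \<in> (\<Union>i\<in>{1..nat (x' - x)}. ?D i)" by blast
  qed
  then have "card {\<sigma>\<in>{..<2 ^ k :: nat}. (x + int \<sigma>) div 2 ^ h \<noteq> (x' + int \<sigma>) div 2 ^ h}
      \<le> card (\<Union>i\<in>{1..nat (x' - x)}. ?D i)" by (intro card_mono) auto
  also have "\<dots> \<le> (\<Sum>i\<in>{1..nat (x' - x)}. card (?D i))" by (rule card_UN_le) simp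
  also have "\<dots> \<le> (\<Sum>i\<in>{1..nat (x' - x)}. 2 ^ (k - h))"
    by (intro sum_mono card_shift_dvd assms)
  also have "\<dots> = nat \<bar>x - x'\<bar> * 2 ^ (k - h)" using le by simp
  finally show ?case .
next
  case (sym x x')
  then show ?case by (simp add: abs_minus_commute eq_commute[of "(x + _) div _"])
qed

text \<open>The tail from \<open>p\<close> on sums to \<open>2\<close>; the subtracted term is the
  part of the tail from \<open>m\<close> on, which makes the induction exact.\<close>

lemma sum_geometric_cap:
  "(\<Sum>h<m. if h < p then 1 else 2 ^ p / 2 ^ h) \<le>
    (if m \<le> p then real m else real p + 2 - 2 * (2 ^ p / 2 ^ m))"
proof (induction m)
  case (Suc m)
  consider "m < p" | "m = p" | "p < m" by linarith
  moreover have "(2::real) ^ p / 2 ^ Suc m = 2 ^ p / 2 ^ m / 2" by simp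
  ultimately show ?case
    by cases (use Suc in \<open>auto simp del: power_Suc\<close>)
qed simp

lemma card_filter_eq_sum:
  "finite S \<Longrightarrow> real (card {x \<in> S. P x}) = (\<Sum>x\<in>S. if P x then 1 else 0)"
  by (simp flip: sum.inter_filter)

text \<open>Levels below \<open>p\<close> count as always separating; at a higher level
  \<open>h\<close> a uniform shift separates with probability at most
  \<open>2 ^ p / 2 ^ h\<close>.\<close>

lemma sum_separated_levels:
  fixes x x' :: int
  assumes x: "0 \<le> x" "x < 2 ^ k" and x': "0 \<le> x'" "x' < 2 ^ k" and d: "\<bar>x - x'\<bar> \<le> 2 ^ p"
  shows "(\<Sum>\<sigma><2 ^ k. real (card {h\<in>{..k + 1}. (x + int \<sigma>) div 2 ^ h \<noteq> (x' + int \<sigma>) div 2 ^ h}))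
    \<le> 2 ^ k * (real p + 2)"
proof -
  let ?N = "\<lambda>h. {\<sigma>\<in>{..<2 ^ k :: nat}. (x + int \<sigma>) div 2 ^ h \<noteq> (x' + int \<sigma>) div 2 ^ h}"
  let ?g = "\<lambda>h. if h < p then 1 else 2 ^ p / 2 ^ h :: real"
  have "(\<Sum>\<sigma><2 ^ k. real (card {h\<in>{..k + 1}. (x + int \<sigma>) div 2 ^ h \<noteq> (x' + int \<sigma>) div 2 ^ h}))
      = (\<Sum>\<sigma><2 ^ k. \<Sum>h\<le>k + 1. if (x + int \<sigma>) div 2 ^ h \<noteq> (x' + int \<sigma>) div 2 ^ h then 1 else 0)"
    by (intro sum.cong refl card_filter_eq_sum[symmetric] card_filter_eq_sum) simp_all
  also have "\<dots> = (\<Sum>h\<le>k + 1. \<Sum>\<sigma><2 ^ k. if (x + int \<sigma>) div 2 ^ h \<noteq> (x' + int \<sigma>) div 2 ^ h then 1 else 0)"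
    by (rule sum.swap)
  also have "\<dots> = (\<Sum>h\<le>k + 1. real (card (?N h)))"
    by (intro sum.cong refl card_filter_eq_sum[symmetric] card_filter_eq_sum) simp_all
  \<comment> \<open>All shifted points are below \<open>2 ^ (k + 1)\<close>, so level
    \<open>k + 1\<close> separates nothing; the counting bound covers only levels up to
    \<open>k\<close>.\<close>
  also have "\<dots> = (\<Sum>h<k + 1. real (card (?N h)))"
  proof -
    have "(x + int \<sigma>) div 2 ^ (k + 1) = 0" "(x' + int \<sigma>) div 2 ^ (k + 1) = 0" if "\<sigma> < 2 ^ k" for \<sigma>
    proof -
      have "int \<sigma> < 2 ^ k" using that by (metis of_nat_less_iff of_nat_numeral of_nat_power)
      then have "x + int \<sigma> < 2 ^ (k + 1)" "x' + int \<sigma> < 2 ^ (k + 1)"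
        using x x' unfolding Suc_eq_plus1[symmetric] power_Suc by linarith+
      then show "(x + int \<sigma>) div 2 ^ (k + 1) = 0" "(x' + int \<sigma>) div 2 ^ (k + 1) = 0"
        using x x' by (simp_all add: div_pos_pos_trivial)
    qed
    then have "?N (k + 1) = {}" by auto
    then have "card (?N (k + 1)) = 0" by (metis card.empty)
    moreover have "{..k + 1} = insert (k + 1) {..<k + 1}" by auto
    ultimately show ?thesis by simp
  qed
  also have "\<dots> \<le> (\<Sum>h<k + 1. 2 ^ k * ?g h)"
  proof (rule sum_mono)
    fix h assume h: "h \<in> {..<k + 1}"
    show "real (card (?N h)) \<le> 2 ^ k * ?g h"
    proof (cases "h < p")
      case True
      have "card (?N h) \<le> card {..<2 ^ k :: nat}" by (rule card_mono) auto
      then have "real (card (?N h)) \<le> real (2 ^ k)" by (simp only: card_lessThan of_nat_le_iff)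
      then show ?thesis using True by simp
    next
      case False
      have "card (?N h) \<le> nat \<bar>x - x'\<bar> * 2 ^ (k - h)" using h by (intro card_separating_shifts) auto
      also have "\<dots> \<le> 2 ^ p * 2 ^ (k - h)" using d by (intro mult_right_mono) (auto simp: nat_le_iff)
      finally have "real (card (?N h)) \<le> real (2 ^ p * 2 ^ (k - h))" by (simp only: of_nat_le_iff)
      also have "\<dots> = 2 ^ p * 2 ^ (k - h)" by simp
      also have "\<dots> = 2 ^ k * ?g h" using h False by (subst power_diff) simp_all
      finally show ?thesis .
    qed
  qed
  also have "\<dots> = 2 ^ k * (\<Sum>h<k + 1. ?g h)" by (simp only: sum_distrib_left)
  also have "\<dots> \<le> 2 ^ k * (real p + 2)"
  proof (rule mult_left_mono)
    have "(if k + 1 \<le> p then real (k + 1) else real p + 2 - 2 * (2 ^ p / 2 ^ (k + 1))) \<le> real p + 2"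
      by simp
    then show "(\<Sum>h<k + 1. ?g h) \<le> real p + 2" using sum_geometric_cap[of p "k + 1"] by linarith
  qed simp
  finally show ?thesis .
qed

section \<open>Comparison with the bound and choice of a shift\<close>

lemma lg_ge_1: "1 \<le> lg x"
proof -
  have "log 2 2 \<le> log 2 (max 2 x)" by (subst log_le_cancel_iff) auto
  then show ?thesis by (simp add: lg_def)
qed

lemma lg_mono: "x \<le> z \<Longrightarrow> lg x \<le> lg z"
  unfolding lg_def by (subst log_le_cancel_iff) auto

text \<open>Rounding \<open>lg x\<close> up to \<open>p\<close> gives \<open>p + 2\<close> at most
  \<open>lg x + 3\<close>, hence at most \<open>4 * lg x\<close> because \<open>lg x\<close> is at
  least \<open>1\<close>.\<close>

lemma power_two_ge: "\<exists>p. x \<le> 2 ^ p \<and> real p + 2 \<le> 4 * lg x"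
proof -
  define p where "p = nat \<lceil>lg x\<rceil>"
  have p: "lg x \<le> real p" "real p \<le> lg x + 1" using lg_ge_1[of x] unfolding p_def by linarith+
  have "x \<le> 2 powr lg x" by (simp add: lg_def)
  also have "\<dots> \<le> 2 powr real p" using p by (intro powr_mono) auto
  finally have "x \<le> 2 ^ p" by (simp add: powr_realpow)
  then show ?thesis using p lg_ge_1[of x] by (intro exI[of _ p]) auto
qed

text \<open>Take \<open>u\<close> attaining the minimum. As \<open>lg\<close> is monotone, dropping
  the nonnegative \<open>rho\<close> only lowers the term.\<close>

lemma window_term_bound:
  assumes "1 \<le> l" "2 \<le> t"
  shows "\<exists>u p. u \<in> {t - l..t - 1} \<and> 1 \<le> u \<and> \<bar>int (acc X t) - int (acc X u)\<bar> \<le> 2 ^ p \<and>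
    real p + 2 \<le> 4 * Min ((\<lambda>t'. lg (\<bar>real (acc X t) - real (acc X t')\<bar> + real (rho X t (acc X t'))))
                 ` {t'. t - l \<le> t' \<and> t' < t \<and> 1 \<le> t'})"
proof -
  let ?f = "\<lambda>t'. lg (\<bar>real (acc X t) - real (acc X t')\<bar> + real (rho X t (acc X t')))"
  let ?W = "{t'. t - l \<le> t' \<and> t' < t \<and> 1 \<le> t'}"
  have "finite ?W" by (rule finite_subset[of _ "{..t}"]) auto
  moreover have "t - 1 \<in> ?W" using assms by auto
  ultimately have "Min (?f ` ?W) \<in> ?f ` ?W" by (intro Min_in) auto
  then obtain u where u: "u \<in> ?W" "Min (?f ` ?W) = ?f u" by auto
  obtain p where p: "\<bar>real (acc X t) - real (acc X u)\<bar> \<le> 2 ^ p"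
    "real p + 2 \<le> 4 * lg \<bar>real (acc X t) - real (acc X u)\<bar>" using power_two_ge by blast
  have "real_of_int \<bar>int (acc X t) - int (acc X u)\<bar> \<le> real_of_int (2 ^ p)" using p(1) by simp
  then have "\<bar>int (acc X t) - int (acc X u)\<bar> \<le> 2 ^ p" by (simp only: of_int_le_iff)
  moreover have "lg \<bar>real (acc X t) - real (acc X u)\<bar> \<le> ?f u" by (rule lg_mono) simp
  ultimately show ?thesis using u p(2) by (intro exI[of _ u] exI[of _ p]) auto
qed

lemma OPT_le_UB:
  assumes l: "1 \<le> l" and X: "set X \<subseteq> {1..n}" "X \<noteq> []"
  shows "real (OPT n X) \<le> real (209 * (l + 1)) * UB l n X"
proof -
  define m where "m = length X"
  define f where "f t = (if t = 1 then lg (real n)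
      else Min ((\<lambda>t'. lg (\<bar>real (acc X t) - real (acc X t')\<bar> + real (rho X t (acc X t'))))
                 ` {t'. t - l \<le> t' \<and> t' < t \<and> 1 \<le> t'}))" for t
  define U where "U = (\<Sum>t = 1..m. f t)"
  have UB: "UB l n X = U" by (simp add: UB_def U_def f_def m_def)
  have m: "1 \<le> m" using X by (cases X) (auto simp: m_def)
  have acc: "acc X t \<in> {1..n}" if "t \<le> m" for t
    using X m that unfolding acc_def m_def by (intro subsetD[OF X(1)] nth_mem) auto
  have n1: "1 \<le> n" using acc[of 0] by auto
  have f1: "1 \<le> f t" if "t \<in> {1..m}" for t
  proof (cases "t = 1")
    case True
    then show ?thesis by (simp add: f_def lg_ge_1)
  next
    case False
    let ?W = "{t'. t - l \<le> t' \<and> t' < t \<and> 1 \<le> t'}"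
    have "finite ?W" by (rule finite_subset[of _ "{..t}"]) auto
    moreover have "t - 1 \<in> ?W" using l that False by auto
    ultimately have "1 \<le> Min ((\<lambda>t'. lg (\<bar>real (acc X t) - real (acc X t')\<bar> + real (rho X t (acc X t')))) ` ?W)"
      by (intro Min.boundedI) (use lg_ge_1 in auto)
    then show ?thesis using False by (simp add: f_def)
  qed
  have mU: "real m \<le> U" using sum_mono[of "{1..m}" "\<lambda>_. 1" f] f1 by (simp add: U_def)
  have lgU: "lg (real n) \<le> U"
  proof -
    have "f 1 \<le> U" unfolding U_def using m f1 by (intro member_le_sum) (auto intro: order_trans[of 0 1])
    then show ?thesis by (simp add: f_def)
  qed
  obtain k where k: "n < 2 ^ k" "real k + 2 \<le> 4 * lg (real n)"
  proof -
    define k where "k = nat \<lfloor>log 2 (real n)\<rfloor> + 1"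
    have "0 \<le> log 2 (real n)" using n1 by simp
    then have k: "log 2 (real n) < real k" "real k \<le> log 2 (real n) + 1" unfolding k_def by linarith+
    have "real n < 2 powr real k" using k(1) n1 by (simp add: log_less_iff)
    then have "n < 2 ^ k" by (simp add: powr_realpow)
    moreover have "log 2 (real n) \<le> lg (real n)" unfolding lg_def using n1 by (subst log_le_cancel_iff) auto
    then have "real k + 2 \<le> 4 * lg (real n)" using k(2) lg_ge_1[of "real n"] by linarith
    ultimately show ?thesis by (rule that)
  qed
  \<comment> \<open>\<open>min s m\<close> prolongs the accesses beyond time \<open>m\<close>, as a
    window system needs a point at every time. Keys and shifts are below \<open>2 ^ k\<close>, hence
    \<open>k + 1\<close> levels above the bottom.\<close>
  define y where "y \<sigma> s = int (acc X (min s m)) + int \<sigma>" for \<sigma> s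
  have y: "window_system (k + 1) l (y \<sigma>)" if "\<sigma> < 2 ^ k" for \<sigma>
  proof
    fix s
    have "acc X (min s m) < 2 ^ k" using acc[of "min s m"] k(1) by auto
    then have "acc X (min s m) + \<sigma> < 2 ^ (k + 1)" using that by simp
    then have "int (acc X (min s m) + \<sigma>) < int (2 ^ (k + 1))" by (simp only: of_nat_less_iff)
    then show "y \<sigma> s < 2 ^ (k + 1)" by (simp add: y_def)
  qed (use l in \<open>auto simp: y_def\<close>)
  let ?new = "\<lambda>\<sigma>. window_system.new (k + 1) l (y \<sigma>)"
  have each: "(\<Sum>\<sigma><2 ^ k. real (?new \<sigma> t)) \<le> 2 ^ k * (4 * f t)" if t: "t \<in> {1..m}" for t
  proof -
    have "\<exists>u p. u \<in> {t - l..t - 1} \<and> \<bar>int (acc X t) - int (acc X u)\<bar> \<le> 2 ^ p \<and> real p + 2 \<le> 4 * f t"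
    proof (cases "t = 1")
      case True
      \<comment> \<open>Truncated subtraction makes time \<open>0\<close> repeat the first access,
        so that access creates no cell.\<close>
      have "acc X 0 = acc X 1" by (simp add: acc_def)
      moreover have "0 \<in> {t - l..t - 1}" using True l by simp
      moreover have "real 0 + 2 \<le> 4 * f t" using f1[OF t] by simp
      ultimately show ?thesis using True by (intro exI[of _ 0] exI[of _ "0::nat"]) simp
    next
      case False
      then show ?thesis using window_term_bound[OF l, of t X] t by (auto simp: f_def)
    qed
    then obtain u p where u: "u \<in> {t - l..t - 1}"
      "\<bar>int (acc X t) - int (acc X u)\<bar> \<le> 2 ^ p" "real p + 2 \<le> 4 * f t" by blast
    have um: "u \<le> m" "t \<le> m" using u(1) t by auto
    have lt: "0 \<le> int (acc X s) \<and> int (acc X s) < 2 ^ k" if "s \<le> m" for s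
    proof -
      have "acc X s < 2 ^ k" using acc[OF that] k(1) by auto
      then have "int (acc X s) < int (2 ^ k)" by (simp only: of_nat_less_iff)
      then show ?thesis by simp
    qed
    have "(\<Sum>\<sigma><2 ^ k. real (?new \<sigma> t)) \<le> (\<Sum>\<sigma><2 ^ k. real (card {h\<in>{..k + 1}.
        (int (acc X t) + int \<sigma>) div 2 ^ h \<noteq> (int (acc X u) + int \<sigma>) div 2 ^ h}))"
    proof (rule sum_mono)
      fix \<sigma> assume "\<sigma> \<in> {..<2 ^ k :: nat}"
      then have "window_system (k + 1) l (y \<sigma>)" using y by simp
      from window_system.new_le[OF this u(1)]
      show "real (?new \<sigma> t) \<le> real (card {h\<in>{..k + 1}.
        (int (acc X t) + int \<sigma>) div 2 ^ h \<noteq> (int (acc X u) + int \<sigma>) div 2 ^ h})"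
        using um by (simp add: y_def)
    qed
    also have "\<dots> \<le> 2 ^ k * (real p + 2)"
      using lt[OF um(1)] lt[OF um(2)] u(2) by (intro sum_separated_levels) auto
    also have "\<dots> \<le> 2 ^ k * (4 * f t)" using u(3) by (intro mult_left_mono) auto
    finally show ?thesis .
  qed
  have "(\<Sum>\<sigma><2 ^ k. \<Sum>t = 1..m. real (?new \<sigma> t)) = (\<Sum>t = 1..m. \<Sum>\<sigma><2 ^ k. real (?new \<sigma> t))"
    by (rule sum.swap)
  also have "\<dots> \<le> (\<Sum>t = 1..m. 2 ^ k * (4 * f t))" by (rule sum_mono) (rule each)
  also have "\<dots> = 2 ^ k * (4 * U)" by (simp add: U_def sum_distrib_left)
  finally have total: "(\<Sum>\<sigma><2 ^ k. \<Sum>t = 1..m. real (?new \<sigma> t)) \<le> 2 ^ k * (4 * U)" .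
  have "\<exists>\<sigma><2 ^ k. (\<Sum>t = 1..m. real (?new \<sigma> t)) \<le> 4 * U"
  proof (rule ccontr)
    assume "\<not> ?thesis"
    then have "(\<Sum>\<sigma><2 ^ k :: nat. 4 * U) < (\<Sum>\<sigma><2 ^ k. \<Sum>t = 1..m. real (?new \<sigma> t))"
      by (intro sum_strict_mono) (auto simp: not_le lessThan_empty_iff)
    then show False using total by simp
  qed
  then obtain \<sigma> where s: "\<sigma> < 2 ^ k" "(\<Sum>t = 1..m. real (?new \<sigma> t)) \<le> 4 * U" by blast
  interpret window_system "k + 1" l "y \<sigma>" by (rule y[OF s(1)])
  have "real (OPT n X) \<le> real (\<Sum>t = 1..m. 8 * card (touched n \<sigma> t) + 1)"
    unfolding of_nat_le_iff m_def
  proof (rule OPT_le_satisfied[OF satisfied_touched])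
    fix t assume "t \<in> {1..length X}"
    then have "t \<le> m" by (simp add: m_def)
    moreover from this have "y \<sigma> t = int (acc X t) + int \<sigma>" by (simp add: y_def)
    ultimately show "acc X t \<in> touched n \<sigma> t \<and> touched n \<sigma> t \<subseteq> {1..n}"
      using y_mem_bd[of t] acc[of t] unfolding touched_def by auto
  qed
  \<comment> \<open>The factor \<open>16\<close> is eight operations per touched key times two ends
    per cell.\<close>
  also have "\<dots> \<le> real (\<Sum>t = 1..m. 16 * (l + 1) * (new t + old t + 1) + 1)"
    unfolding of_nat_le_iff
  proof (rule sum_mono)
    fix t
    have "L t \<le> new t + old t" unfolding L_def by linarith
    then have "(l + 1) * (L t + 1) \<le> (l + 1) * (new t + old t + 1)" by (intro mult_left_mono) simp_all
    then show "8 * card (touched n \<sigma> t) + 1 \<le> 16 * (l + 1) * (new t + old t + 1) + 1"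
      using card_touched[of n \<sigma> t] by linarith
  qed
  also have "\<dots> = 16 * (real l + 1) * ((\<Sum>t = 1..m. real (new t)) + real (\<Sum>t = 1..m. old t) + real m) + real m"
    by (simp add: sum.distrib sum_distrib_left[symmetric] algebra_simps)
  also have "\<dots> \<le> 16 * (real l + 1) * (13 * U) + (real l + 1) * U"
  proof (rule add_mono)
    have "real (\<Sum>t = 1..m. old t) \<le> real ((\<Sum>t = 1..m. new t) + (k + 1 + 1))"
      unfolding of_nat_le_iff by (rule sum_old_le)
    also have "\<dots> = (\<Sum>t = 1..m. real (new t)) + (real k + 2)" by simp
    \<comment> \<open>Arrivals contribute \<open>4 * U\<close>, departures another
      \<open>4 * U\<close> plus \<open>k + 2\<close>, which is at most \<open>4 * U\<close>, and the
      unit per access gives \<open>U\<close>: in all \<open>13 * U\<close>. The constant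
      \<open>209\<close> is \<open>16 * 13 + 1\<close>.\<close>
    finally have "(\<Sum>t = 1..m. real (new t)) + real (\<Sum>t = 1..m. old t) + real m \<le> 13 * U"
      using s(2) k(2) lgU mU by linarith
    then show "16 * (real l + 1) * ((\<Sum>t = 1..m. real (new t)) + real (\<Sum>t = 1..m. old t) + real m)
      \<le> 16 * (real l + 1) * (13 * U)" by (intro mult_left_mono) auto
    have "1 * real m \<le> (real l + 1) * U" using mU by (intro mult_mono) auto
    then show "real m \<le> (real l + 1) * U" by simp
  qed
  also have "\<dots> = real (209 * (l + 1)) * U" by (simp add: algebra_simps)
  finally show ?thesis unfolding UB .
qed

theorem theorem1:
  "\<exists>\<beta> :: nat \<Rightarrow> nat. \<forall>l n m X. 1 \<le> l \<longrightarrow> n \<le> m \<longrightarrow> length X = m \<longrightarrow> set X \<subseteq> {1..n} \<longrightarrow>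
      real (OPT n X) \<le> real (\<beta> l) * UB l n X"
proof (intro exI allI impI)
  fix l n m :: nat and X :: "nat list"
  assume *: "1 \<le> l" "n \<le> m" "length X = m" "set X \<subseteq> {1..n}"
  show "real (OPT n X) \<le> real (209 * (l + 1)) * UB l n X"
  proof (cases "X = []")
    case True
    then have "OPT n X = 0"
      using OPT_le_satisfied[of X "\<lambda>_. {}" n] by (simp add: satisfied_def)
    then show ?thesis using True by (simp add: UB_def)
  next
    case False
    then show ?thesis using OPT_le_UB * by simp
  qed
qed

end
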